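(* Let $0 \le k < d$ be integers and let $\varepsilon, \eta, \kappa, \alpha, c_0 > 0$ be real numbers. Then there exists a constant $C$, depending only on $d,k,\varepsilon,\eta,\kappa,\alpha,c_0$, such that the following holds for every positive integer $N$. Set $Q = N^{\varepsilon/(2d)}$, let $P \subseteq \mathcal{P}(Q)$ satisfy $w(P) \ge \kappa \log Q$, and let $S \subseteq [N]^d$ be a set with $|S| \ge c_0 N^{k-1+\varepsilon}$ occupying at most $\alpha p^k$ residue classes modulo $p$ for every prime $p \in P$. Then there exists a polynomial $f \in \mathbb{Z}[x_1,\ldots,x_d]$ of degree at most $C$, with all coefficients bounded in absolute value by $N^C$, which vanishes at more than $(1-\eta)|S|$ points of $S$.
   Context: $[N] = \{0,1,\ldots,N\}$. $\mathcal{P}(Q)$ denotes the set of primes $p \le Q$, and for a finite set of primes $P$, $w(P) := \sum_{p \in P} \frac{\log p}{p}$. A set $S \subseteq \mathbb{Z}^d$ occupies $m$ residue classes mod $p$ if its image in $(\mathbb{Z}/p\mathbb{Z})^d$ has $m$ elements. *)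

theory Defs
  imports "HOL-Computational_Algebra.Primes" Complex_Main
begin

text \<open>Points of Z^d are functions nat => int vanishing outside {0..<d}.\<close>

definition grid :: "nat \<Rightarrow> nat \<Rightarrow> (nat \<Rightarrow> int) set" where
  "grid N d = {x. (\<forall>i<d. 0 \<le> x i \<and> x i \<le> int N) \<and> (\<forall>i\<ge>d. x i = 0)}"

definition residue_classes :: "nat \<Rightarrow> (nat \<Rightarrow> int) set \<Rightarrow> (nat \<Rightarrow> int) set" where
  "residue_classes p S = (\<lambda>x. (\<lambda>i. x i mod int p)) ` S"

definition wP :: "nat set \<Rightarrow> real" where
  "wP P = (\<Sum>p\<in>P. ln (real p) / real p)"

definition exps :: "nat \<Rightarrow> real \<Rightarrow> (nat \<Rightarrow> nat) set" where
  "exps d D = {e. (\<forall>i\<ge>d. e i = 0) \<and> real (\<Sum>i<d. e i) \<le> D}"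

definition poly_eval :: "nat \<Rightarrow> real \<Rightarrow> ((nat \<Rightarrow> nat) \<Rightarrow> int) \<Rightarrow> (nat \<Rightarrow> int) \<Rightarrow> int" where
  "poly_eval d D a x = (\<Sum>e\<in>exps d D. a e * (\<Prod>i<d. x i ^ e i))"

end

theory Submission
  imports Defs "HOL-Library.FuncSet"
begin

text \<open>
  The key is a characteristic subset: a set \<open>A \<subseteq> S\<close> of only \<open>O(D^k)\<close> points such that every function
  which respects congruences, is at most \<open>N^D\<close> on the grid and vanishes on \<open>A\<close> vanishes on a positive
  proportion of \<open>S\<close>. As \<open>O(D^k)\<close> is much smaller than the \<open>D^d\<close> available monomials, Siegel's lemma
  yields a polynomial of degree \<open>O(D)\<close> vanishing on \<open>A\<close>; iterating on the remaining part of \<open>S\<close>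
  raises the proportion beyond \<open>1 - \<eta>\<close>.

  Characteristic subsets come from induction on \<open>k\<close>. For \<open>k = 0\<close> Gallagher's larger sieve bounds \<open>S\<close>.
  Otherwise the size of \<open>S\<close> forces some coordinate whose sections are all small compared with \<open>S / Q\<close>
  on a positive proportion of \<open>S\<close>. Since a nonzero difference in \<open>[N]\<close> is divisible by few primes,
  this coordinate is equidistributed modulo most primes, so typical sections occupy \<open>O(p^(k-1))\<close>
  classes and the induction hypothesis applies to them. Two sections that are congruent modulo \<open>p\<close> share
  residue classes with probability bounded below, so the choice of \<open>O(D)\<close> suitable sections makes
  the sum of \<open>log p\<close> over the primes for which \<open>x\<close> is congruent to a point of a chosen section exceed \<open>D log N\<close>
  for a positive proportion of the \<open>x\<close>. A function vanishing on these sections is then divisible at \<open>x\<close>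
  by an integer larger than its size, so it vanishes at \<open>x\<close>.
\<close>

section \<open>Counting residues and primes\<close>

definition res :: "nat \<Rightarrow> (nat \<Rightarrow> int) \<Rightarrow> nat \<Rightarrow> int" where
  "res p x = (\<lambda>i. x i mod int p)"

lemma residue_classes_eq: "residue_classes p S = res p ` S"
  by (simp add: residue_classes_def res_def image_def)

text \<open>Restriction to \<open>{..<d}\<close> turns functions with a constant tail
  \<open>z\<close> into extensional functions, which \<open>card_PiE\<close> counts. The box serves
  three times: for the grid, for the points with all coordinates heavy, and for the exponents in
  Siegel's lemma.\<close>

lemma finite_card_box:
  fixes B :: "nat \<Rightarrow> 'a set" and z :: 'a
  assumes "\<And>i. i < d \<Longrightarrow> finite (B i)"
  shows "finite {e. (\<forall>i<d. e i \<in> B i) \<and> (\<forall>i\<ge>d. e i = z)}"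
    and "card {e. (\<forall>i<d. e i \<in> B i) \<and> (\<forall>i\<ge>d. e i = z)} = (\<Prod>i<d. card (B i))"
proof -
  let ?E = "{e. (\<forall>i<d. e i \<in> B i) \<and> (\<forall>i\<ge>d. e i = z)}"
  let ?r = "\<lambda>e. restrict e {..<d}"
  have bij: "bij_betw ?r ?E (PiE {..<d} B)"
  proof (rule bij_betw_byWitness[where f' = "\<lambda>e i. if i < d then e i else z"])
    show "\<forall>e\<in>?E. (\<lambda>i. if i < d then ?r e i else z) = e"
      by (auto simp: fun_eq_iff)
    show "\<forall>e\<in>PiE {..<d} B. ?r (\<lambda>i. if i < d then e i else z) = e"
      by (auto simp: fun_eq_iff PiE_def extensional_def)
    show "?r ` ?E \<subseteq> PiE {..<d} B"
      by (auto simp: PiE_def Pi_def)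
    show "(\<lambda>e i. if i < d then e i else z) ` PiE {..<d} B \<subseteq> ?E"
      by (auto simp: PiE_def Pi_def)
  qed
  show "finite ?E"
    using bij_betw_finite[OF bij] finite_PiE[of "{..<d}" B] assms by simp
  show "card ?E = (\<Prod>i<d. card (B i))"
    using bij_betw_same_card[OF bij] by (simp add: card_PiE)
qed

lemma finite_grid: "finite (grid N d)"
proof -
  have "grid N d = {e. (\<forall>i<d. e i \<in> {0..int N}) \<and> (\<forall>i\<ge>d. e i = 0)}"
    by (auto simp: grid_def)
  then show ?thesis using finite_card_box(1)[of d "\<lambda>_. {0..int N}" 0] by simp
qed

section \<open>Primes dividing a nonzero integer, and the weight of a set of primes\<close>

lemma prod_primes_dvd_int:
  fixes n :: int
  assumes "finite P" and "\<And>p. p \<in> P \<Longrightarrow> prime p \<and> int p dvd n"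
  shows "int (\<Prod>P) dvd n"
  using assms
proof (induction P rule: finite_induct)
  case (insert p P)
  have "coprime (int p) (int (\<Prod>P))"
    using insert by (intro coprime_int_iff[THEN iffD2] prod_coprime_right) (auto intro!: primes_coprime)
  moreover have "int p dvd n" "int (\<Prod>P) dvd n" using insert by auto
  ultimately show ?case using insert.hyps by (simp add: divides_mult)
qed simp

text \<open>Distinct primes dividing \<open>n\<close> have a product dividing \<open>n\<close>, and
  a nonzero integer is at least as large as its divisors. Used in two directions: a nonzero
  difference of coordinates has few prime divisors, and a value with too many prime divisors must be
  zero.\<close>

lemma sum_ln_primes_le:
  fixes n :: int
  assumes "finite P" and "\<And>p. p \<in> P \<Longrightarrow> prime p \<and> int p dvd n" and "n \<noteq> 0"
  shows "(\<Sum>p\<in>P. ln (real p)) \<le> ln (real_of_int \<bar>n\<bar>)"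
proof -
  have pos: "0 < real p" if "p \<in> P" for p using assms(2)[OF that] prime_gt_0_nat by simp
  have "int (\<Prod>P) \<le> \<bar>n\<bar>"
    using prod_primes_dvd_int[OF assms(1,2)] assms(3) dvd_imp_le_int by (metis abs_of_nat)
  then have le: "real (\<Prod>P) \<le> real_of_int \<bar>n\<bar>" by linarith
  have "(\<Sum>p\<in>P. ln (real p)) = ln (\<Prod>p\<in>P. real p)"
    using assms(1) pos by (subst ln_prod) auto
  also have "\<dots> = ln (real (\<Prod>P))" by simp
  also have "\<dots> \<le> ln (real_of_int \<bar>n\<bar>)"
    using le pos by (intro ln_mono) (auto simp: prod_pos)
  finally show ?thesis .
qed

lemma ln_prime_nonneg: "prime p \<Longrightarrow> 0 \<le> ln (real p)"
  using prime_ge_1_nat[of p] by simp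

lemma wP_nonneg:
  assumes "\<And>p. p \<in> P \<Longrightarrow> prime p"
  shows "wP P \<ge> 0"
  unfolding wP_def using assms by (intro sum_nonneg divide_nonneg_nonneg ln_prime_nonneg) auto

lemma wP_mono:
  assumes "finite P" "\<And>p. p \<in> P \<Longrightarrow> prime p" "P' \<subseteq> P"
  shows "wP P' \<le> wP P"
  unfolding wP_def using assms by (intro sum_mono2 divide_nonneg_nonneg ln_prime_nonneg) auto

lemma wP_Un_le:
  assumes "finite P" "finite P'" "\<And>p. p \<in> P \<Longrightarrow> prime p" "\<And>p. p \<in> P' \<Longrightarrow> prime p"
  shows "wP (P \<union> P') \<le> wP P + wP P'"
proof -
  have "wP (P \<inter> P') \<ge> 0" using assms by (intro wP_nonneg) auto
  then show ?thesis using sum.union_inter[OF assms(1,2), of "\<lambda>p. ln (real p) / real p"]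
    unfolding wP_def by linarith
qed

text \<open>Each summand is at most 1, so discarding all primes up to \<open>Y\<close> costs at most
  \<open>Y\<close>. This is affordable because the total weight grows like \<open>ln N\<close> while
  \<open>Y\<close> stays fixed.\<close>

lemma wP_small_primes_le:
  assumes "finite P" "\<And>p. p \<in> P \<Longrightarrow> prime p" "\<And>p. p \<in> P \<Longrightarrow> p \<le> Y"
  shows "wP P \<le> real Y"
proof -
  have "wP P \<le> (\<Sum>p\<in>P. 1)" unfolding wP_def
  proof (rule sum_mono)
    fix p assume "p \<in> P"
    then have "real p > 0" using assms(2) prime_gt_0_nat by auto
    then show "ln (real p) / real p \<le> 1" using ln_le_minus_one[of "real p"] by (simp add: divide_simps)
  qed
  also have "\<dots> = real (card P)" by simp
  also have "card P \<le> card {1..Y}"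
    using assms prime_ge_1_nat by (intro card_mono) auto
  finally show ?thesis by simp
qed

lemma card_markov:
  fixes g :: "'a \<Rightarrow> real"
  assumes "finite S" "\<And>x. x \<in> S \<Longrightarrow> g x \<ge> 0" "(\<Sum>x\<in>S. g x) \<le> M"
  shows "a * real (card {x\<in>S. g x > a}) \<le> M"
proof -
  have "a * real (card {x\<in>S. g x > a}) = (\<Sum>x\<in>{x\<in>S. g x > a}. a)" by simp
  also have "\<dots> \<le> (\<Sum>x\<in>{x\<in>S. g x > a}. g x)" by (intro sum_mono) auto
  also have "\<dots> \<le> (\<Sum>x\<in>S. g x)" using assms by (intro sum_mono2) auto
  finally show ?thesis using assms by linarith
qed

lemma sum_ln_diff_le:
  assumes "finite P" "\<And>p. p \<in> P \<Longrightarrow> prime p" "u \<noteq> t" "0 \<le> u" "u \<le> int N" "0 \<le> t" "t \<le> int N"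
  shows "(\<Sum>p\<in>{p\<in>P. u mod int p = t mod int p}. ln (real p)) \<le> ln (real N)"
proof -
  have "(\<Sum>p\<in>{p\<in>P. u mod int p = t mod int p}. ln (real p)) \<le> ln (real_of_int \<bar>u - t\<bar>)"
    using assms by (intro sum_ln_primes_le) (auto simp: mod_eq_dvd_iff)
  also have "\<dots> \<le> ln (real N)"
    using assms by (intro ln_mono) auto
  finally show ?thesis .
qed

section \<open>Double counting of sections and residue classes\<close>

lemma sum_card_swap:
  fixes h :: "nat \<Rightarrow> real"
  assumes "finite P" "finite S"
  shows "(\<Sum>p\<in>P. h p * real (card {x\<in>S. R x p})) = (\<Sum>x\<in>S. \<Sum>p\<in>{p\<in>P. R x p}. h p)"
proof -
  have "(\<Sum>p\<in>P. h p * real (card {x\<in>S. R x p})) = (\<Sum>p\<in>P. \<Sum>x\<in>{x\<in>S. R x p}. h p)"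
    by (simp add: mult.commute)
  also have "\<dots> = (\<Sum>x\<in>S. \<Sum>p\<in>{p\<in>P. R x p}. h p)"
    using assms by (rule sum.swap_restrict)
  finally show ?thesis .
qed

text \<open>Count pairs of a point x and a prime p dividing \<open>x i - t\<close>, weighted by
  \<open>ln p\<close>. A point off the section \<open>x i = t\<close> contributes at most
  \<open>ln N\<close>, and the points on it contribute at most \<open>card S * ln N\<close>
  altogether by \<open>light\<close>. A heavy prime alone contributes more than
  \<open>b * card S * ln p / p\<close>, which bounds the weight of the heavy primes.\<close>

lemma heavy_primes_weight_le:
  assumes S: "S \<subseteq> grid N d" "S \<noteq> {}" and i: "i < d" and t: "0 \<le> t" "t \<le> int N"
    and P: "finite P" "\<And>p. p \<in> P \<Longrightarrow> prime p" and N: "N > 0"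
    and light: "real (card {x\<in>S. x i = t}) * (\<Sum>p\<in>P. ln (real p)) \<le> real (card S) * ln (real N)"
    and b: "b > 0"
  shows "wP {p\<in>P. real (card {x\<in>S. x i mod int p = t mod int p}) > b * real (card S) / real p}
    \<le> 2 * ln (real N) / b"
proof -
  have fin: "finite S" using S finite_grid finite_subset by blast
  have cS: "card S > 0" using fin S by (simp add: card_gt_0_iff)
  let ?n = "\<lambda>p. real (card {x\<in>S. x i mod int p = t mod int p})"
  let ?H = "{p\<in>P. ?n p > b * real (card S) / real p}"
  have lnp: "ln (real p) \<ge> 0" if "p \<in> P" for p using P(2)[OF that] by (rule ln_prime_nonneg)
  have lnN: "ln (real N) \<ge> 0" using N by simp
  have "(\<Sum>p\<in>P. ln (real p) * ?n p) = (\<Sum>x\<in>S. \<Sum>p\<in>{p\<in>P. x i mod int p = t mod int p}. ln (real p))"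
    by (rule sum_card_swap[OF P(1) fin])
  also have "\<dots> \<le> (\<Sum>x\<in>S. ln (real N) + (if x i = t then \<Sum>p\<in>P. ln (real p) else 0))"
  proof (rule sum_mono)
    fix x assume x: "x \<in> S"
    show "(\<Sum>p\<in>{p\<in>P. x i mod int p = t mod int p}. ln (real p))
      \<le> ln (real N) + (if x i = t then \<Sum>p\<in>P. ln (real p) else 0)"
    proof (cases "x i = t")
      case True then show ?thesis using lnN by simp
    next
      case False
      have "0 \<le> x i" "x i \<le> int N" using x S i by (auto simp: grid_def)
      then show ?thesis using sum_ln_diff_le[OF P False _ _ t] False by simp
    qed
  qed
  also have "\<dots> = real (card S) * ln (real N) + real (card {x\<in>S. x i = t}) * (\<Sum>p\<in>P. ln (real p))"
    using fin by (simp add: sum.distrib sum.If_cases Int_def)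
  also have "\<dots> \<le> 2 * real (card S) * ln (real N)" using light by simp
  finally have main: "(\<Sum>p\<in>P. ln (real p) * ?n p) \<le> 2 * real (card S) * ln (real N)" .
  have "b * real (card S) * wP ?H = (\<Sum>p\<in>?H. ln (real p) * (b * real (card S) / real p))"
    by (simp add: wP_def sum_distrib_left mult.commute)
  also have "\<dots> \<le> (\<Sum>p\<in>?H. ln (real p) * ?n p)"
    using lnp by (intro sum_mono mult_left_mono) auto
  also have "\<dots> \<le> (\<Sum>p\<in>P. ln (real p) * ?n p)"
    using lnp P by (intro sum_mono2) auto
  finally have "real (card S) * (b * wP ?H) \<le> real (card S) * (2 * ln (real N))" using main by (simp add: mult_ac)
  then have "b * wP ?H \<le> 2 * ln (real N)" using cS by simp
  then show ?thesis using b by (simp add: pos_le_divide_eq mult.commute)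
qed

text \<open>The fibres of \<open>x i\<close> modulo p occupy disjoint sets of residue classes, so at
  most \<open>\<alpha> * p / L\<close> of them can occupy more than \<open>L * p ^ k\<close>
  classes. Each of those counted here has at most \<open>b * card S / p\<close> points.\<close>

lemma crowded_residues_card_le:
  fixes \<alpha> b L :: real
  assumes fin: "finite S" and p: "p > 0" and L: "L > 0" and b: "b > 0"
    and cl: "real (card (res p ` S)) \<le> \<alpha> * real p ^ Suc k"
  shows "real (card {x\<in>S. real (card (res p ` {y\<in>S. y i mod int p = x i mod int p})) > L * real p ^ k
       \<and> real (card {y\<in>S. y i mod int p = x i mod int p}) \<le> b * real (card S) / real p})
     \<le> \<alpha> * b / L * real (card S)"
proof -
  let ?F = "\<lambda>r. {y\<in>S. y i mod int p = r}"
  define R where "R = {r \<in> (\<lambda>x. x i mod int p) ` S. real (card (res p ` ?F r)) > L * real p ^ k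
     \<and> real (card (?F r)) \<le> b * real (card S) / real p}"
  have finR: "finite R" using fin by (simp add: R_def)
  have disj: "res p ` ?F r \<inter> res p ` ?F r' = {}" if "r \<noteq> r'" for r r'
  proof -
    have eq: "c i = r" if "c \<in> res p ` ?F r" for c r using that by (auto simp: res_def)
    show ?thesis
    proof (rule equals0I)
      fix c assume "c \<in> res p ` ?F r \<inter> res p ` ?F r'"
      then show False using eq[of c r] eq[of c r'] that by blast
    qed
  qed
  have "real (card R) * (L * real p ^ k) = (\<Sum>r\<in>R. L * real p ^ k)" by simp
  also have "\<dots> \<le> (\<Sum>r\<in>R. real (card (res p ` ?F r)))" by (intro sum_mono) (auto simp: R_def)
  also have "\<dots> = real (card (\<Union>r\<in>R. res p ` ?F r))"
    using finR fin disj by (subst card_UN_disjoint) auto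
  also have "\<dots> \<le> real (card (res p ` S))" using fin by (intro of_nat_mono card_mono) auto
  also note cl
  finally have "real (card R) * L * real p ^ k \<le> \<alpha> * real p * real p ^ k" by (simp add: mult_ac)
  then have cR: "real (card R) * L \<le> \<alpha> * real p" using p by simp
  let ?X = "{x\<in>S. real (card (res p ` ?F (x i mod int p))) > L * real p ^ k
       \<and> real (card (?F (x i mod int p))) \<le> b * real (card S) / real p}"
  have "real (card ?X) \<le> real (card (\<Union>r\<in>R. ?F r))"
    using finR fin by (intro of_nat_mono card_mono) (auto simp: R_def)
  also have "\<dots> \<le> (\<Sum>r\<in>R. real (card (?F r)))" using of_nat_mono[OF card_UN_le[OF finR, of ?F]] by simp
  also have "\<dots> \<le> (\<Sum>r\<in>R. b * real (card S) / real p)" by (intro sum_mono) (auto simp: R_def)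
  also have "\<dots> = (real (card R) * L) * (b * real (card S) / (real p * L))" using L by simp
  also have "\<dots> \<le> (\<alpha> * real p) * (b * real (card S) / (real p * L))"
    using cR b L p by (intro mult_right_mono) auto
  also have "\<dots> = \<alpha> * b / L * real (card S)" using p by simp
  finally show ?thesis .
qed

text \<open>At most \<open>1 / \<sigma>\<close> values of a coordinate are attained by a proportion
  \<open>\<sigma>\<close> of the points. Points all of whose coordinates take such values lie in a
  box of at most \<open>(1 / \<sigma>) ^ d\<close> points, hence form at most half of
  \<open>S\<close>. Every other point has a light coordinate, and pigeonhole over the d coordinates
  gives the claim.\<close>

lemma light_coordinate:
  assumes S: "S \<subseteq> grid N d" and \<sigma>: "\<sigma> > 0" and d: "d > 0"
    and big: "(1 / \<sigma>) ^ d \<le> real (card S) / 2"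
  shows "\<exists>i<d. real (card {x\<in>S. real (card {y\<in>S. y i = x i}) < \<sigma> * real (card S)}) \<ge> real (card S) / (2 * real d)"
proof -
  have fin: "finite S" using S finite_grid finite_subset by blast
  have cS: "real (card S) > 0" using big \<sigma>
    by (metis divide_pos_pos half_gt_zero_iff less_le_trans zero_less_one zero_less_power)
  define L where "L i = {x\<in>S. real (card {y\<in>S. y i = x i}) < \<sigma> * real (card S)}" for i
  define H where "H i = {t \<in> (\<lambda>x. x i) ` S. real (card {y\<in>S. y i = t}) \<ge> \<sigma> * real (card S)}" for i
  have finH: "finite (H i)" for i using fin by (simp add: H_def)
  have cH: "real (card (H i)) \<le> 1 / \<sigma>" for i
  proof -
    have "real (card (H i)) * (\<sigma> * real (card S)) = (\<Sum>t\<in>H i. \<sigma> * real (card S))" by simp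
    also have "\<dots> \<le> (\<Sum>t\<in>H i. real (card {y\<in>S. y i = t}))" by (intro sum_mono) (auto simp: H_def)
    also have "\<dots> = real (card (\<Union>t\<in>H i. {y\<in>S. y i = t}))"
      using finH fin by (subst card_UN_disjoint) auto
    also have "\<dots> \<le> real (card S)" using fin by (intro of_nat_mono card_mono) auto
    finally have "real (card (H i)) * \<sigma> * real (card S) \<le> 1 * real (card S)" by simp
    then have "real (card (H i)) * \<sigma> \<le> 1" using cS mult_le_cancel_right_pos by blast
    then show ?thesis using \<sigma> by (simp add: pos_le_divide_eq)
  qed
  let ?B = "{e. (\<forall>i<d. e i \<in> H i) \<and> (\<forall>i\<ge>d. e i = 0)}"
  have finB: "finite ?B" and cB: "card ?B = (\<Prod>i<d. card (H i))"
    using finite_card_box[of d H 0] finH by auto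
  have "real (card ?B) = (\<Prod>i<d. real (card (H i)))" by (simp add: cB)
  also have "\<dots> \<le> (\<Prod>i<d. 1 / \<sigma>)" using cH by (intro prod_mono) auto
  finally have cB': "real (card ?B) \<le> real (card S) / 2" using big by simp
  have "S \<subseteq> ?B \<union> (\<Union>i<d. L i)" using S by (auto simp: L_def H_def grid_def not_less)
  then have "card S \<le> card (?B \<union> (\<Union>i<d. L i))"
    using finB fin by (intro card_mono) (auto simp: L_def)
  also have "\<dots> \<le> card ?B + (\<Sum>i<d. card (L i))"
    by (rule order.trans[OF card_Un_le add_left_mono[OF card_UN_le]]) simp
  finally have "card S \<le> card ?B + (\<Sum>i<d. card (L i))" .
  then have "real (card S) \<le> real (card ?B + (\<Sum>i<d. card (L i)))" by (rule of_nat_mono)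
  then have "real (card S) \<le> real (card ?B) + (\<Sum>i<d. real (card (L i)))" by simp
  with cB' have half: "real (card S) / 2 \<le> (\<Sum>i<d. real (card (L i)))" by linarith
  show ?thesis
  proof (rule ccontr)
    assume "\<not> ?thesis"
    then have lt: "real (card (L i)) < real (card S) / (2 * real d)" if "i < d" for i
      using that by (auto simp: L_def not_le)
    have "(\<Sum>i<d. real (card (L i))) < (\<Sum>i<d. real (card S) / (2 * real d))"
      using lt d by (intro sum_strict_mono) auto
    also have "\<dots> = real (card S) / 2" using d by simp
    finally show False using half by simp
  qed
qed

section \<open>Covering by few sections\<close>

lemma sum_UN_le:
  fixes w :: "'b \<Rightarrow> real"
  assumes "finite Z" "\<And>z. z \<in> Z \<Longrightarrow> finite (E z)" "\<And>z e. z \<in> Z \<Longrightarrow> e \<in> E z \<Longrightarrow> 0 \<le> w e"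
  shows "sum w (\<Union>z\<in>Z. E z) \<le> (\<Sum>z\<in>Z. sum w (E z))"
  using assms
proof (induction Z rule: finite_induct)
  case (insert z Z)
  let ?U = "\<Union>z\<in>Z. E z"
  have U: "finite ?U" "finite (E z)" using insert by auto
  have "sum w (E z \<union> ?U) + sum w (E z \<inter> ?U) = sum w (E z) + sum w ?U"
    using U by (intro sum.union_inter)
  moreover have "0 \<le> sum w (E z \<inter> ?U)" using insert by (intro sum_nonneg) auto
  moreover have "sum w ?U \<le> (\<Sum>z\<in>Z. sum w (E z))" using insert by auto
  ultimately show ?case using insert.hyps by simp
qed simp

text \<open>Sets are chosen one at a time. Their average weight is at least \<open>c\<close>, while
  fewer than \<open>m\<close> sets already chosen take away at most \<open>c / 2\<close> on average,
  so some set always adds at least \<open>c / 2\<close> of new weight.\<close>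

lemma greedy_cover:
  fixes w :: "'b \<Rightarrow> real" and E :: "'a \<Rightarrow> 'b set" and c :: real
  assumes Y: "finite Y" "Y \<noteq> {}" and E: "\<And>y. y \<in> Y \<Longrightarrow> finite (E y)"
    and w: "\<And>y e. y \<in> Y \<Longrightarrow> e \<in> E y \<Longrightarrow> 0 \<le> w e"
    and total: "c * real (card Y) \<le> (\<Sum>y\<in>Y. sum w (E y))"
    and overlap: "\<And>z. z \<in> Y \<Longrightarrow> (\<Sum>y\<in>Y. sum w (E y \<inter> E z)) \<le> c / (2 * real m) * real (card Y)"
    and m: "m > 0" and c: "c \<ge> 0"
  shows "\<exists>Z\<subseteq>Y. card Z \<le> m \<and> real m * c / 2 \<le> sum w (\<Union>z\<in>Z. E z)"
proof -
  have cY: "real (card Y) > 0" using Y by (simp add: card_gt_0_iff)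
  have "\<exists>Z\<subseteq>Y. card Z \<le> j \<and> real j * c / 2 \<le> sum w (\<Union>z\<in>Z. E z)" if "j \<le> m" for j
    using that
  proof (induction j)
    case 0
    then show ?case by (intro exI[of _ "{}"]) auto
  next
    case (Suc j)
    then obtain Z where Z: "Z \<subseteq> Y" "card Z \<le> j" "real j * c / 2 \<le> sum w (\<Union>z\<in>Z. E z)" by auto
    have finZ: "finite Z" using Z(1) Y(1) finite_subset by blast
    let ?U = "\<Union>z\<in>Z. E z"
    have finU: "finite ?U" using finZ Z(1) E by auto
    have "\<exists>y\<in>Y. c / 2 \<le> sum w (E y - ?U)"
    proof (rule ccontr)
      assume "\<not> ?thesis"
      then have lt: "sum w (E y - ?U) < c / 2" if "y \<in> Y" for y using that by (auto simp: not_le)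
      have "sum w (E y) \<le> sum w (E y - ?U) + (\<Sum>z\<in>Z. sum w (E y \<inter> E z))" if y: "y \<in> Y" for y
      proof -
        have "sum w (E y) = sum w (E y - ?U) + sum w (E y \<inter> ?U)"
          by (subst sum.union_disjoint[symmetric]) (auto simp: E[OF y] Un_Diff_Int)
        also have "E y \<inter> ?U = (\<Union>z\<in>Z. E y \<inter> E z)" by auto
        also have "sum w (\<Union>z\<in>Z. E y \<inter> E z) \<le> (\<Sum>z\<in>Z. sum w (E y \<inter> E z))"
          using finZ E w y by (intro sum_UN_le) auto
        finally show ?thesis by simp
      qed
      then have "(\<Sum>y\<in>Y. sum w (E y)) \<le> (\<Sum>y\<in>Y. sum w (E y - ?U) + (\<Sum>z\<in>Z. sum w (E y \<inter> E z)))"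
        by (rule sum_mono)
      also have "\<dots> = (\<Sum>y\<in>Y. sum w (E y - ?U)) + (\<Sum>z\<in>Z. \<Sum>y\<in>Y. sum w (E y \<inter> E z))"
        by (simp add: sum.distrib sum.swap[of _ Y])
      \<comment> \<open>The overlap hypothesis is used once for each chosen set; since
        \<open>card Z \<le> j < m\<close>, the overlaps consume at most half of the total.\<close>
      also have "\<dots> < (\<Sum>y\<in>Y. c / 2) + (\<Sum>z\<in>Z. c / (2 * real m) * real (card Y))"
        using lt Y overlap Z(1) by (intro add_less_le_mono sum_strict_mono sum_mono) auto
      also have "\<dots> = c / 2 * real (card Y) + (c / 2 * real (card Y)) * (real (card Z) / real m)" by (simp add: mult_ac)
      also have "\<dots> \<le> c / 2 * real (card Y) + (c / 2 * real (card Y)) * 1"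
        using Z(2) Suc.prems c by (intro add_left_mono mult_left_mono) (auto simp: divide_simps)
      finally show False using total by simp
    qed
    then obtain y where y: "y \<in> Y" "c / 2 \<le> sum w (E y - ?U)" by auto
    have "sum w (\<Union>z\<in>insert y Z. E z) = sum w ((E y - ?U) \<union> ?U)"
      by (rule arg_cong[where f = "sum w"]) auto
    also have "\<dots> = sum w (E y - ?U) + sum w ?U"
      using finU E[OF y(1)] by (intro sum.union_disjoint) auto
    finally have "real (Suc j) * c / 2 \<le> sum w (\<Union>z\<in>insert y Z. E z)"
      using y(2) Z(3) by (simp add: field_simps)
    moreover have "card (insert y Z) \<le> Suc j" using Z(2) finZ card_insert_le_m1[of "Suc j" Z y] by simp
    ultimately show ?case using y(1) Z(1) by (intro exI[of _ "insert y Z"]) auto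
  qed
  from this[of m] show ?thesis by simp
qed

text \<open>Cauchy-Schwarz for the fibre sizes of \<open>f\<close>: they sum to
  \<open>card A\<close> and their squares sum to the number of collisions. The proof expands the
  nonnegative sum of squared deviations from the mean \<open>?t\<close>.\<close>

lemma card_sq_le_collisions:
  assumes "finite A"
  shows "(real (card A))\<^sup>2 \<le> real (card (f ` A)) * (\<Sum>x\<in>A. real (card {y\<in>A. f y = f x}))"
proof -
  let ?n = "\<lambda>c. real (card {y\<in>A. f y = c})"
  define s where "s = (\<Sum>c\<in>f ` A. (?n c)\<^sup>2)"
  have A: "A = (\<Union>c\<in>f ` A. {y\<in>A. f y = c})" by auto
  have "real (card A) = (\<Sum>c\<in>f ` A. ?n c)"
    using assms by (subst A, subst card_UN_disjoint) auto
  have s_eq: "(\<Sum>x\<in>A. ?n (f x)) = s"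
    unfolding s_def sum.image_gen[OF assms, of "\<lambda>x. ?n (f x)" f]
    by (intro sum.cong) (auto simp: power2_eq_square)
  let ?r = "real (card (f ` A))"
  show ?thesis
  proof (cases "A = {}")
    case False
    then have r: "?r > 0" using assms by (simp add: card_gt_0_iff)
    let ?t = "real (card A) / ?r"
    have "0 \<le> (\<Sum>c\<in>f ` A. (?n c - ?t)\<^sup>2)" by (intro sum_nonneg) auto
    also have "\<dots> = (\<Sum>c\<in>f ` A. (?n c)\<^sup>2 - 2 * ?t * ?n c + ?t\<^sup>2)"
      by (simp add: power2_diff algebra_simps)
    also have "\<dots> = s - 2 * ?t * (\<Sum>c\<in>f ` A. ?n c) + ?r * ?t\<^sup>2"
      by (simp add: s_def sum.distrib sum_subtractf sum_distrib_left)
    also have "\<dots> = s - (real (card A))\<^sup>2 / ?r"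
      using r by (simp add: \<open>real (card A) = _\<close>[symmetric] power2_eq_square)
    finally show ?thesis using r by (simp add: s_eq pos_divide_le_eq mult.commute)
  qed simp
qed

text \<open>A section covers the pair of p and x if its piece \<open>S' t\<close> meets the class of
  x modulo p. Since \<open>S\<close> has few classes, points collide often modulo p; since one
  section holds few points of a class (\<open>few\<close>), these collisions spread over many
  sections, so an average section covers a positive proportion of the weight. Two sections cover
  little in common, because that forces congruences modulo p, and
  \<open>\<Sum>p. ln p / p ^ 2\<close> over large p is small. Then \<open>greedy_cover\<close>
  applies.\<close>

lemma section_cover:
  fixes S :: "(nat \<Rightarrow> int) set" and T :: "int set" and S' :: "int \<Rightarrow> (nat \<Rightarrow> int) set"
    and G :: "int \<Rightarrow> nat \<Rightarrow> (nat \<Rightarrow> int) set" and \<alpha> \<beta> b c \<delta> :: real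
  defines "X \<equiv> (\<Union>t\<in>T. S' t)"
  assumes fin: "finite S" "finite T"
    and sub: "\<And>t. t \<in> T \<Longrightarrow> S' t \<subseteq> {x\<in>S. x i = t}"
    and P: "finite P" "\<And>p. p \<in> P \<Longrightarrow> prime p"
    and Pt: "\<And>t. t \<in> T \<Longrightarrow> Pt t \<subseteq> P"
    and cl: "\<And>p. p \<in> P \<Longrightarrow> real (card (res p ` S)) \<le> \<alpha> * real p ^ Suc k"
    and few: "\<And>t p y. t \<in> T \<Longrightarrow> p \<in> Pt t \<Longrightarrow>
      real (card {z\<in>S' t. z \<in> G t p \<and> res p z = res p y}) \<le> \<beta> * real (card (S' t)) / real p ^ k"
    and nonheavy: "\<And>t p. t \<in> T \<Longrightarrow> p \<in> Pt t \<Longrightarrow>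
      real (card {x\<in>S. x i mod int p = t mod int p}) \<le> b * real (card S) / real p"
    and wt: "\<And>t x. t \<in> T \<Longrightarrow> x \<in> S' t \<Longrightarrow> c * wP P \<le> wP {p\<in>Pt t. x \<in> G t p}"
    and pos: "\<alpha> > 0" "\<beta> > 0" "b > 0" "c > 0" "\<delta> > 0" "m > 0" "Y > 0"
    and X: "X \<noteq> {}" "\<delta> * real (card S) \<le> real (card X)"
    and Y: "real Y \<le> c / 2 * wP P" "b\<^sup>2 / (\<delta>\<^sup>2 * real Y) \<le> (c / 2)\<^sup>2 / (\<alpha> * \<beta>) / (2 * real m)"
  shows "\<exists>Z\<subseteq>T. card Z \<le> m \<and> real m * ((c / 2)\<^sup>2 / (\<alpha> * \<beta>) * wP P * real (card X)) / 2
    \<le> (\<Sum>x\<in>X. \<Sum>p\<in>{p\<in>P. \<exists>t\<in>Z. p \<in> Pt t \<and> res p x \<in> res p ` S' t}. ln (real p))"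
proof -
  let ?W = "wP P"
  \<comment> \<open>\<open>Gp p\<close> keeps the points for which p is admissible in their own
    section and their class is not overpopulated. \<open>R p x y\<close> says that the section
    through y covers the class of x. \<open>E y\<close> therefore depends on y only through
    \<open>y i\<close>; indexing by points instead of sections weights each section by its
    size.\<close>
  define Gp where "Gp p = {x\<in>X. p \<in> Pt (x i) \<and> x \<in> G (x i) p}" for p
  define R where "R p x y \<longleftrightarrow> p \<in> Pt (y i) \<and> res p x \<in> res p ` S' (y i)" for p x y
  \<comment> \<open>Beyond \<open>Y\<close> one has
    \<open>ln p / p ^ 2 \<le> (ln p / p) / Y\<close>, which makes the overlaps small.\<close>
  define P' where "P' = {p\<in>P. p > Y}"
  define E where "E y = Sigma P' (\<lambda>p. {x\<in>Gp p. R p x y})" for y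
  define w where "w = (\<lambda>(p::nat, x::nat \<Rightarrow> int). ln (real p))"
  have XS: "X \<subseteq> S" using sub by (auto simp: X_def)
  have finX: "finite X" using XS fin finite_subset by blast
  have finGp: "finite (Gp p)" for p using finX by (simp add: Gp_def)
  have GpX: "Gp p \<subseteq> X" for p by (auto simp: Gp_def)
  have finP': "finite P'" using P by (simp add: P'_def)
  have Xt: "x i \<in> T \<and> x \<in> S' (x i)" if "x \<in> X" for x using that sub by (fastforce simp: X_def)
  have ppos: "real p > 0" if "p \<in> P" for p using P(2)[OF that] prime_gt_0_nat by simp
  have lnp: "0 \<le> ln (real p)" if "p \<in> P" for p using P(2)[OF that] by (rule ln_prime_nonneg)
  have W: "?W \<ge> 0" using P(2) by (rule wP_nonneg)
  have cX: "real (card X) > 0" using X finX by (simp add: card_gt_0_iff)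
  have Rmod: "x i mod int p = y i mod int p" if R: "R p x y" and y: "y \<in> X" for p x y
  proof -
    obtain z where z: "z \<in> S' (y i)" "res p x = res p z" using R by (auto simp: R_def)
    have "z i = y i" using z sub Xt[OF y] by auto
    with z(2) show ?thesis unfolding res_def by metis
  qed

  \<comment> \<open>A section meeting the class of \<open>x0\<close> contributes at most a fraction
    \<open>\<beta> / p ^ k\<close> of its piece to that class, and the pieces of all sections that
    meet the class form the set counted on the right.\<close>
  have rowsum: "real (card {x\<in>Gp p. res p x = res p x0}) \<le> \<beta> / real p ^ k * real (card {y\<in>X. R p x0 y})"
    if p: "p \<in> P'" for p x0
  proof -
    let ?T = "{t\<in>T. p \<in> Pt t \<and> res p x0 \<in> res p ` S' t}"
    have finT: "finite ?T" using fin by simp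
    have finS': "finite (S' t)" if "t \<in> T" for t
      using sub[OF that] fin finite_subset[of "S' t" S] by auto
    have "{x\<in>Gp p. res p x = res p x0} \<subseteq> (\<Union>t\<in>?T. {z\<in>S' t. z \<in> G t p \<and> res p z = res p x0})"
    proof
      fix x assume x: "x \<in> {x\<in>Gp p. res p x = res p x0}"
      then have "x i \<in> T" "x \<in> S' (x i)" "p \<in> Pt (x i)" "x \<in> G (x i) p" "res p x = res p x0"
        using Xt by (auto simp: Gp_def)
      then show "x \<in> (\<Union>t\<in>?T. {z\<in>S' t. z \<in> G t p \<and> res p z = res p x0})"
        by (auto intro!: bexI[of _ "x i"] image_eqI[of _ _ x])
    qed
    then have "card {x\<in>Gp p. res p x = res p x0} \<le> card (\<Union>t\<in>?T. {z\<in>S' t. z \<in> G t p \<and> res p z = res p x0})"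
      using finT finS' by (intro card_mono) auto
    also have "\<dots> \<le> (\<Sum>t\<in>?T. card {z\<in>S' t. z \<in> G t p \<and> res p z = res p x0})"
      using finT by (rule card_UN_le)
    finally have "card {x\<in>Gp p. res p x = res p x0} \<le> (\<Sum>t\<in>?T. card {z\<in>S' t. z \<in> G t p \<and> res p z = res p x0})" .
    then have "real (card {x\<in>Gp p. res p x = res p x0}) \<le> real (\<Sum>t\<in>?T. card {z\<in>S' t. z \<in> G t p \<and> res p z = res p x0})"
      by (rule of_nat_mono)
    also have "\<dots> = (\<Sum>t\<in>?T. real (card {z\<in>S' t. z \<in> G t p \<and> res p z = res p x0}))" by simp
    also have "\<dots> \<le> (\<Sum>t\<in>?T. \<beta> * real (card (S' t)) / real p ^ k)" using few by (intro sum_mono) auto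
    also have "\<dots> = \<beta> / real p ^ k * (\<Sum>t\<in>?T. real (card (S' t)))" by (simp add: sum_distrib_left)
    also have "(\<Sum>t\<in>?T. real (card (S' t))) = real (card (\<Union>t\<in>?T. S' t))"
    proof -
      have "S' t \<inter> S' t' = {}" if "t \<in> T" "t' \<in> T" "t \<noteq> t'" for t t'
        using sub[OF that(1)] sub[OF that(2)] that(3) by blast
      then have "card (\<Union>t\<in>?T. S' t) = (\<Sum>t\<in>?T. card (S' t))"
        using finT finS' by (intro card_UN_disjoint) auto
      then show ?thesis by simp
    qed
    also have "\<beta> / real p ^ k * \<dots> \<le> \<beta> / real p ^ k * real (card {y\<in>X. R p x0 y})"
    proof -
      have "(\<Union>t\<in>?T. S' t) \<subseteq> {y\<in>X. R p x0 y}"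
      proof
        fix y assume "y \<in> (\<Union>t\<in>?T. S' t)"
        then obtain t where t: "t \<in> ?T" "y \<in> S' t" by auto
        then have "y i = t" using sub[of t] by auto
        with t show "y \<in> {y\<in>X. R p x0 y}" by (auto simp: X_def R_def)
      qed
      then show ?thesis using finX pos by (intro mult_left_mono of_nat_mono card_mono) auto
    qed
    finally show ?thesis .
  qed

  have sumE: "sum w (E y) = (\<Sum>p\<in>P'. ln (real p) * real (card {x\<in>Gp p. R p x y}))" for y
    unfolding E_def w_def using finP' finGp by (subst sum.Sigma[symmetric]) (auto simp: mult.commute)
  have sumEE: "sum w (E y \<inter> E z) = (\<Sum>p\<in>P'. ln (real p) * real (card {x\<in>{x\<in>Gp p. R p x z}. R p x y}))" for y z
  proof -
    have "E y \<inter> E z = Sigma P' (\<lambda>p. {x\<in>{x\<in>Gp p. R p x z}. R p x y})" by (auto simp: E_def)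
    then show ?thesis unfolding w_def using finP' finGp by (subst \<open>E y \<inter> E z = _\<close>, subst sum.Sigma[symmetric]) (auto simp: mult.commute)
  qed
  have swap: "(\<Sum>y\<in>X. real (card {x\<in>A. R p x y})) = (\<Sum>x\<in>A. real (card {y\<in>X. R p x y}))"
    if "finite A" for p A
    using sum.swap_restrict[OF finX that, of "\<lambda>_ _. 1::real" "\<lambda>y x. R p x y"] by simp

  \<comment> \<open>Cauchy-Schwarz over at most \<open>\<alpha> * p ^ Suc k\<close> classes,
    combined with \<open>rowsum\<close>; the powers of p cancel down to a single factor p.\<close>
  have col: "(real (card (Gp p)))\<^sup>2 / (\<alpha> * \<beta> * real p) \<le> (\<Sum>y\<in>X. real (card {x\<in>Gp p. R p x y}))"
    if p: "p \<in> P'" for p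
  proof -
    have pP: "p \<in> P" using p by (simp add: P'_def)
    let ?M = "\<Sum>y\<in>X. real (card {x\<in>Gp p. R p x y})"
    have "(real (card (Gp p)))\<^sup>2 \<le> real (card (res p ` Gp p)) * (\<Sum>x\<in>Gp p. real (card {y\<in>Gp p. res p y = res p x}))"
      by (rule card_sq_le_collisions[OF finGp])
    also have "\<dots> \<le> (\<alpha> * real p ^ Suc k) * (\<Sum>x\<in>Gp p. \<beta> / real p ^ k * real (card {y\<in>X. R p x y}))"
    proof (rule mult_mono)
      have "card (res p ` Gp p) \<le> card (res p ` S)"
        using fin GpX XS by (intro card_mono) blast+
      then show "real (card (res p ` Gp p)) \<le> \<alpha> * real p ^ Suc k"
        using cl[OF pP] by linarith
      show "(\<Sum>x\<in>Gp p. real (card {y\<in>Gp p. res p y = res p x}))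
        \<le> (\<Sum>x\<in>Gp p. \<beta> / real p ^ k * real (card {y\<in>X. R p x y}))"
        using rowsum[OF p] by (intro sum_mono) auto
    qed (use pos in \<open>auto intro!: sum_nonneg\<close>)
    also have "\<dots> = \<alpha> * \<beta> * real p * (\<Sum>x\<in>Gp p. real (card {y\<in>X. R p x y}))"
      unfolding sum_distrib_left[symmetric] using ppos[OF pP] by simp
    also have "\<dots> = \<alpha> * \<beta> * real p * ?M" by (simp add: swap[OF finGp])
    finally show ?thesis using pos ppos[OF pP] by (simp add: pos_divide_le_eq mult.commute)
  qed

  \<comment> \<open>Dropping the primes up to \<open>Y\<close> costs at most half of the weight
    guaranteed by \<open>wt\<close>.\<close>
  have mean: "c / 2 * ?W * real (card X) \<le> (\<Sum>p\<in>P'. ln (real p) / real p * real (card (Gp p)))"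
  proof -
    have "c / 2 * ?W \<le> wP {p\<in>P'. p \<in> Pt (x i) \<and> x \<in> G (x i) p}" if x: "x \<in> X" for x
    proof -
      let ?A = "{p\<in>P'. p \<in> Pt (x i) \<and> x \<in> G (x i) p}" and ?B = "{p\<in>P. p \<le> Y}"
      have "c * ?W \<le> wP {p\<in>Pt (x i). x \<in> G (x i) p}" using wt Xt[OF x] by blast
      also have "\<dots> \<le> wP (?A \<union> ?B)"
        using P Pt Xt[OF x] by (intro wP_mono) (auto simp: P'_def)
      also have "\<dots> \<le> wP ?A + wP ?B" using P by (intro wP_Un_le) (auto simp: P'_def)
      also have "wP ?B \<le> real Y" using P by (intro wP_small_primes_le) auto
      finally show ?thesis using Y(1) by linarith
    qed
    then have "(\<Sum>x\<in>X. c / 2 * ?W) \<le> (\<Sum>x\<in>X. wP {p\<in>P'. p \<in> Pt (x i) \<and> x \<in> G (x i) p})"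
      by (rule sum_mono)
    also have "\<dots> = (\<Sum>p\<in>P'. ln (real p) / real p * real (card (Gp p)))"
      unfolding wP_def Gp_def by (rule sum_card_swap[OF finP' finX, symmetric])
    finally show ?thesis by (simp add: mult_ac)
  qed

  let ?s = "c / 2 * real (card X)"
  \<comment> \<open>Weighted Cauchy-Schwarz in tangent form:
    \<open>n ^ 2 \<ge> 2 * s * n - s ^ 2\<close> at the point s given by \<open>mean\<close>, so no
    division by the weight of \<open>P'\<close> occurs.\<close>
  have second: "?s\<^sup>2 * ?W \<le> (\<Sum>p\<in>P'. ln (real p) / real p * (real (card (Gp p)))\<^sup>2)"
  proof -
    have wP': "wP P' \<le> ?W" using P by (intro wP_mono) (auto simp: P'_def)
    have "?s\<^sup>2 * ?W \<le> 2 * ?s * (c / 2 * ?W * real (card X)) - ?s\<^sup>2 * wP P'"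
    proof -
      have "?s\<^sup>2 * wP P' \<le> ?s\<^sup>2 * ?W" using wP' by (rule mult_left_mono) simp
      moreover have "2 * ?s * (c / 2 * ?W * real (card X)) = 2 * (?s\<^sup>2 * ?W)" by (simp add: power2_eq_square)
      ultimately show ?thesis by linarith
    qed
    also have "\<dots> \<le> 2 * ?s * (\<Sum>p\<in>P'. ln (real p) / real p * real (card (Gp p))) - ?s\<^sup>2 * wP P'"
      using mean pos by (intro diff_right_mono mult_left_mono) auto
    also have "\<dots> = (\<Sum>p\<in>P'. ln (real p) / real p * (2 * ?s * real (card (Gp p)) - ?s\<^sup>2))"
      unfolding wP_def sum_distrib_left sum_subtractf[symmetric]
      by (intro sum.cong refl) (simp only: right_diff_distrib mult_ac)
    also have "\<dots> \<le> (\<Sum>p\<in>P'. ln (real p) / real p * (real (card (Gp p)))\<^sup>2)"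
    proof (intro sum_mono mult_left_mono)
      fix p assume "p \<in> P'"
      then show "0 \<le> ln (real p) / real p" using lnp by (simp add: P'_def)
      have "0 \<le> (real (card (Gp p)) - ?s)\<^sup>2" by simp
      then show "2 * ?s * real (card (Gp p)) - ?s\<^sup>2 \<le> (real (card (Gp p)))\<^sup>2"
        unfolding power2_diff by (simp add: mult_ac)
    qed
    finally show ?thesis .
  qed

  define c6 where "c6 = (c / 2)\<^sup>2 / (\<alpha> * \<beta>)"
  have c6: "c6 > 0" using pos by (simp add: c6_def)

  have total: "c6 * ?W * real (card X) * real (card X) \<le> (\<Sum>y\<in>X. sum w (E y))"
  proof -
    have "c6 * ?W * real (card X) * real (card X) = ?s\<^sup>2 * ?W / (\<alpha> * \<beta>)"
      by (simp add: c6_def power2_eq_square)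
    also have "\<dots> \<le> (\<Sum>p\<in>P'. ln (real p) / real p * (real (card (Gp p)))\<^sup>2) / (\<alpha> * \<beta>)"
      using second pos by (intro divide_right_mono) auto
    also have "\<dots> = (\<Sum>p\<in>P'. ln (real p) * ((real (card (Gp p)))\<^sup>2 / (\<alpha> * \<beta> * real p)))"
      by (simp add: sum_divide_distrib mult_ac)
    also have "\<dots> \<le> (\<Sum>p\<in>P'. ln (real p) * (\<Sum>y\<in>X. real (card {x\<in>Gp p. R p x y})))"
      using col lnp by (intro sum_mono mult_left_mono) (auto simp: P'_def)
    also have "\<dots> = (\<Sum>y\<in>X. sum w (E y))"
      unfolding sumE by (subst sum.swap) (simp add: sum_distrib_left)
    finally show ?thesis .
  qed

  have overlap: "(\<Sum>y\<in>X. sum w (E y \<inter> E z)) \<le> c6 * ?W * real (card X) / (2 * real m) * real (card X)"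
    if z: "z \<in> X" for z
  proof -
    \<comment> \<open>For fixed z, a common point x lies in the fibre of \<open>z i\<close> modulo
      p, and then y lies in the fibre of \<open>x i\<close>. Both fibres are bounded by
      \<open>nonheavy\<close>: p belongs to \<open>Pt (x i)\<close> as x is in \<open>Gp p\<close>,
      and if p is not in \<open>Pt (z i)\<close> there is nothing to count.\<close>
    have bd: "(\<Sum>y\<in>X. real (card {x\<in>{x\<in>Gp p. R p x z}. R p x y})) \<le> (b * real (card S) / real p)\<^sup>2"
      if p: "p \<in> P'" for p
    proof -
      have pP: "p \<in> P" using p by (simp add: P'_def)
      let ?A = "{x\<in>Gp p. R p x z}" and ?b = "b * real (card S) / real p"
      have b0: "?b \<ge> 0" using pos by simp
      have "(\<Sum>y\<in>X. real (card {x\<in>?A. R p x y})) = (\<Sum>x\<in>?A. real (card {y\<in>X. R p x y}))"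
        using finGp by (intro swap) simp
      also have "\<dots> \<le> (\<Sum>x\<in>?A. ?b)"
      proof (rule sum_mono)
        fix x assume x: "x \<in> ?A"
        then have xX: "x \<in> X" and px: "p \<in> Pt (x i)" by (auto simp: Gp_def)
        have "card {y\<in>X. R p x y} \<le> card {y\<in>S. y i mod int p = x i mod int p}"
          using fin XS Rmod[symmetric] by (intro card_mono) auto
        then show "real (card {y\<in>X. R p x y}) \<le> ?b"
          using nonheavy[of "x i" p] Xt[OF xX] px by linarith
      qed
      also have "\<dots> = real (card ?A) * ?b" by simp
      also have "\<dots> \<le> ?b * ?b"
      proof (rule mult_right_mono[OF _ b0])
        show "real (card ?A) \<le> ?b"
        proof (cases "p \<in> Pt (z i)")
          case True
          have "card ?A \<le> card {x\<in>S. x i mod int p = z i mod int p}"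
            using fin XS GpX Rmod[OF _ z] by (intro card_mono) auto
          then show ?thesis using nonheavy[of "z i" p] Xt[OF z] True by linarith
        next
          case False
          then have "?A = {}" by (simp add: R_def)
          then show ?thesis using b0 by (simp only: card.empty)
        qed
      qed
      finally show ?thesis by (simp add: power2_eq_square)
    qed
    have "(\<Sum>y\<in>X. sum w (E y \<inter> E z)) = (\<Sum>p\<in>P'. ln (real p) * (\<Sum>y\<in>X. real (card {x\<in>{x\<in>Gp p. R p x z}. R p x y})))"
      unfolding sumEE by (subst sum.swap) (simp only: sum_distrib_left)
    also have "\<dots> \<le> (\<Sum>p\<in>P'. ln (real p) * (b * real (card S) / real p)\<^sup>2)"
      using bd lnp by (intro sum_mono mult_left_mono) (auto simp: P'_def)
    also have "\<dots> \<le> (\<Sum>p\<in>P'. (ln (real p) / real p) * (b\<^sup>2 * (real (card S))\<^sup>2 / real Y))"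
    proof (rule sum_mono)
      fix p assume p: "p \<in> P'"
      then have pP: "p \<in> P" and pY: "real Y \<le> real p" by (auto simp: P'_def)
      have "ln (real p) * (b * real (card S) / real p)\<^sup>2
        = (ln (real p) / real p) * (b\<^sup>2 * (real (card S))\<^sup>2 / real p)"
        by (simp add: power2_eq_square)
      also have "\<dots> \<le> (ln (real p) / real p) * (b\<^sup>2 * (real (card S))\<^sup>2 / real Y)"
        using pY pos lnp[OF pP] by (intro mult_left_mono divide_left_mono) auto
      finally show "ln (real p) * (b * real (card S) / real p)\<^sup>2 \<le> \<dots>" .
    qed
    also have "\<dots> = wP P' * (b\<^sup>2 * (real (card S))\<^sup>2 / real Y)" unfolding wP_def sum_distrib_right ..
    also have "\<dots> \<le> ?W * (b\<^sup>2 * (real (card S))\<^sup>2 / real Y)"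
      using P by (intro mult_right_mono wP_mono) (auto simp: P'_def)
    also have "\<dots> \<le> ?W * (b\<^sup>2 * (real (card X) / \<delta>)\<^sup>2 / real Y)"
    proof -
      have "real (card S) \<le> real (card X) / \<delta>" using X(2) pos by (simp add: pos_le_divide_eq mult.commute)
      then show ?thesis using W by (intro mult_left_mono divide_right_mono power_mono) auto
    qed
    also have "\<dots> = ?W * (real (card X))\<^sup>2 * (b\<^sup>2 / (\<delta>\<^sup>2 * real Y))" by (simp add: power_divide)
    also have "\<dots> \<le> ?W * (real (card X))\<^sup>2 * (c6 / (2 * real m))"
      using Y(2) W by (intro mult_left_mono) (auto simp: c6_def)
    also have "\<dots> = c6 * ?W * real (card X) / (2 * real m) * real (card X)" by (simp add: power2_eq_square)
    finally show ?thesis .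
  qed

  have "\<exists>Z\<subseteq>X. card Z \<le> m \<and> real m * (c6 * ?W * real (card X)) / 2 \<le> sum w (\<Union>z\<in>Z. E z)"
  proof (rule greedy_cover)
    show "finite (E y)" for y using finP' finGp by (auto simp: E_def)
    show "0 \<le> w e" if "e \<in> E y" for y e using that lnp by (auto simp: E_def w_def P'_def)
    show "0 \<le> c6 * ?W * real (card X)" using c6 W by simp
  qed (use finX X total overlap pos in auto)
  then obtain Z where Z: "Z \<subseteq> X" "card Z \<le> m" "real m * (c6 * ?W * real (card X)) / 2 \<le> sum w (\<Union>z\<in>Z. E z)"
    by blast
  have finZ: "finite Z" using Z(1) finX finite_subset by blast
  \<comment> \<open>The greedy choice returns points; only their sections matter. Below, the
    restrictions to \<open>P'\<close> and to \<open>Gp\<close> are dropped, which only enlarges the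
    sum.\<close>
  define T' where "T' = (\<lambda>y. y i) ` Z"
  let ?cov = "\<lambda>x p. \<exists>t\<in>T'. p \<in> Pt t \<and> res p x \<in> res p ` S' t"
  let ?D = "Sigma P (\<lambda>p. {x\<in>X. ?cov x p})"
  have "sum w (\<Union>z\<in>Z. E z) \<le> sum w ?D"
  proof (rule sum_mono2)
    show "finite ?D" using P finX by auto
    show "(\<Union>z\<in>Z. E z) \<subseteq> ?D" by (auto simp: E_def P'_def R_def T'_def Gp_def)
    show "0 \<le> w e" if "e \<in> ?D - (\<Union>z\<in>Z. E z)" for e using that lnp by (auto simp: w_def)
  qed
  also have "sum w ?D = (\<Sum>p\<in>P. ln (real p) * real (card {x\<in>X. ?cov x p}))"
    unfolding w_def using P finX by (subst sum.Sigma[symmetric]) (auto simp: mult.commute)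
  also have "\<dots> = (\<Sum>x\<in>X. \<Sum>p\<in>{p\<in>P. ?cov x p}. ln (real p))"
    by (rule sum_card_swap[OF P(1) finX])
  finally have "real m * (c6 * ?W * real (card X)) / 2 \<le> (\<Sum>x\<in>X. \<Sum>p\<in>{p\<in>P. ?cov x p}. ln (real p))"
    using Z(3) by linarith
  moreover have "T' \<subseteq> T" using Z(1) Xt by (auto simp: T'_def)
  moreover have "card T' \<le> m" using card_image_le[OF finZ, of "\<lambda>y. y i"] Z(2) by (simp add: T'_def)
  ultimately show ?thesis unfolding c6_def by blast
qed

section \<open>Characteristic subsets\<close>

text \<open>This and a size bound are the only properties of a polynomial that the capture argument
  uses, so the induction on k can proceed without any reference to degrees or coefficients.\<close>

definition cong_preserving :: "((nat \<Rightarrow> int) \<Rightarrow> int) \<Rightarrow> bool" where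
  "cong_preserving f \<longleftrightarrow> (\<forall>p x y. res p x = res p y \<longrightarrow> int p dvd f x - f y)"

text \<open>
  The set \<open>A\<close> is the characteristic subset. The set \<open>G p\<close> collects points whose residue class modulo \<open>p\<close>
  is not overpopulated; the last two clauses make \<open>S'\<close> reasonably equidistributed among at least about
  \<open>p^k\<close> classes, which is what the induction on \<open>k\<close> needs in order to compare two sections.
\<close>

definition capturable ::
  "nat \<Rightarrow> nat \<Rightarrow> nat \<Rightarrow> nat \<Rightarrow> nat set \<Rightarrow> real \<Rightarrow> real \<Rightarrow> real \<Rightarrow> nat \<Rightarrow> (nat \<Rightarrow> int) set \<Rightarrow> bool" where
  "capturable N d k D P \<delta> \<beta> c K S \<longleftrightarrow> (\<exists>S'\<subseteq>S. \<exists>A\<subseteq>S. \<exists>G.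
     \<delta> * real (card S) \<le> real (card S') \<and> card A \<le> K * D ^ k \<and>
     (\<forall>f. cong_preserving f \<longrightarrow> (\<forall>x\<in>grid N d. \<bar>f x\<bar> \<le> int N ^ D) \<longrightarrow> (\<forall>x\<in>A. f x = 0)
        \<longrightarrow> (\<forall>x\<in>S'. f x = 0)) \<and>
     (\<forall>p\<in>P. \<forall>y. real (card {z\<in>S'. z \<in> G p \<and> res p z = res p y}) \<le> \<beta> * real (card S') / real p ^ k) \<and>
     (\<forall>x\<in>S'. c * wP P \<le> wP {p\<in>P. x \<in> G p}))"

section \<open>Base case by the larger sieve, and the inductive step\<close>

lemma sum_ln_primes_bound:
  assumes "\<And>p. p \<in> P \<Longrightarrow> prime p \<and> real p \<le> x" "x \<ge> 1"
  shows "finite P" "(\<Sum>p\<in>P. ln (real p)) \<le> x * ln x"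
proof -
  have sub: "P \<subseteq> {1..nat \<lfloor>x\<rfloor>}"
  proof
    fix p assume "p \<in> P"
    then have "prime p" "real p \<le> x" using assms by auto
    then show "p \<in> {1..nat \<lfloor>x\<rfloor>}" using prime_ge_1_nat[of p] by (simp add: le_nat_floor)
  qed
  then show fin: "finite P" using finite_subset by blast
  have "card P \<le> nat \<lfloor>x\<rfloor>" using card_mono[OF _ sub] by simp
  then have c: "real (card P) \<le> x" using assms(2) by linarith
  have "(\<Sum>p\<in>P. ln (real p)) \<le> (\<Sum>p\<in>P. ln x)"
  proof (rule sum_mono)
    fix p assume "p \<in> P"
    then show "ln (real p) \<le> ln x" using assms(1)[of p] prime_gt_0_nat[of p] by (intro ln_mono) auto
  qed
  also have "\<dots> \<le> x * ln x" using c assms(2) by (simp add: mult_right_mono)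
  finally show "(\<Sum>p\<in>P. ln (real p)) \<le> x * ln x" .
qed

text \<open>Gallagher's argument: sum \<open>card_sq_le_collisions\<close> over the primes with
  weights \<open>ln p\<close>. A point collides with itself for every prime, contributing the full
  sum, and with any other point for primes of total log at most \<open>ln N\<close>. By
  \<open>big\<close> the latter part is at most half of the left side and can be absorbed.\<close>

lemma larger_sieve:
  fixes \<alpha> :: real
  assumes S: "S \<subseteq> grid N d" "S \<noteq> {}" and N: "N > 0" and \<alpha>: "\<alpha> > 0"
    and P: "finite P" "\<And>p. p \<in> P \<Longrightarrow> prime p"
    and cl: "\<And>p. p \<in> P \<Longrightarrow> real (card (res p ` S)) \<le> \<alpha>"
    and big: "2 * \<alpha> * ln (real N) \<le> (\<Sum>p\<in>P. ln (real p))" "(\<Sum>p\<in>P. ln (real p)) > 0"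
  shows "real (card S) \<le> 2 * \<alpha>"
proof -
  let ?\<theta> = "\<Sum>p\<in>P. ln (real p)" and ?s = "real (card S)"
  have fin: "finite S" using S finite_grid finite_subset by blast
  have s: "?s > 0" using S fin by (simp add: card_gt_0_iff)
  have lnN: "ln (real N) \<ge> 0" using N by simp
  have lnp: "0 \<le> ln (real p)" if "p \<in> P" for p using P(2)[OF that] by (rule ln_prime_nonneg)
  have row: "(\<Sum>p\<in>P. ln (real p) * real (card {y\<in>S. res p y = res p x})) \<le> ?\<theta> + ?s * ln (real N)"
    if x: "x \<in> S" for x
  proof -
    have "(\<Sum>p\<in>P. ln (real p) * real (card {y\<in>S. res p y = res p x}))
      = (\<Sum>y\<in>S. \<Sum>p\<in>{p\<in>P. res p y = res p x}. ln (real p))"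
      by (rule sum_card_swap[OF P(1) fin])
    also have "\<dots> \<le> (\<Sum>y\<in>S. ln (real N) + (if y = x then ?\<theta> else 0))"
    proof (rule sum_mono)
      fix y assume y: "y \<in> S"
      show "(\<Sum>p\<in>{p\<in>P. res p y = res p x}. ln (real p)) \<le> ln (real N) + (if y = x then ?\<theta> else 0)"
      proof (cases "y = x")
        case True then show ?thesis using lnN by simp
      next
        case False
        then obtain i where i: "y i \<noteq> x i" by auto
        then have "i < d" using x y S unfolding grid_def by (metis (mono_tags, lifting) mem_Collect_eq not_less subsetD)
        then have r: "0 \<le> y i" "y i \<le> int N" "0 \<le> x i" "x i \<le> int N" using x y S by (auto simp: grid_def)
        have "(\<Sum>p\<in>{p\<in>P. res p y = res p x}. ln (real p)) \<le> (\<Sum>p\<in>{p\<in>P. y i mod int p = x i mod int p}. ln (real p))"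
          using P lnp by (intro sum_mono2) (auto simp: res_def fun_eq_iff)
        also have "\<dots> \<le> ln (real N)" by (rule sum_ln_diff_le[OF P i r])
        finally show ?thesis using False by simp
      qed
    qed
    also have "\<dots> = ?\<theta> + ?s * ln (real N)" using fin x by (simp add: sum.distrib)
    finally show ?thesis .
  qed
  have "?\<theta> * ?s\<^sup>2 = (\<Sum>p\<in>P. ln (real p) * ?s\<^sup>2)" by (simp add: sum_distrib_right)
  also have "\<dots> \<le> (\<Sum>p\<in>P. ln (real p) * (\<alpha> * (\<Sum>x\<in>S. real (card {y\<in>S. res p y = res p x}))))"
  proof (intro sum_mono mult_left_mono)
    fix p assume p: "p \<in> P"
    show "?s\<^sup>2 \<le> \<alpha> * (\<Sum>x\<in>S. real (card {y\<in>S. res p y = res p x}))"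
      by (rule order.trans[OF card_sq_le_collisions[OF fin, of "res p"]])
        (intro mult_right_mono cl p sum_nonneg, simp)
  qed (use lnp in auto)
  also have "\<dots> = \<alpha> * (\<Sum>x\<in>S. \<Sum>p\<in>P. ln (real p) * real (card {y\<in>S. res p y = res p x}))"
    by (subst sum.swap) (simp add: sum_distrib_left mult_ac)
  also have "\<dots> \<le> \<alpha> * (\<Sum>x\<in>S. ?\<theta> + ?s * ln (real N))"
    using row \<alpha> by (intro mult_left_mono sum_mono) auto
  also have "\<dots> = (\<alpha> * ?\<theta> + \<alpha> * ln (real N) * ?s) * ?s" by (simp add: algebra_simps)
  finally have "(?\<theta> * ?s) * ?s \<le> (\<alpha> * ?\<theta> + \<alpha> * ln (real N) * ?s) * ?s" by (simp add: power2_eq_square mult_ac)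
  then have "?\<theta> * ?s \<le> \<alpha> * ?\<theta> + \<alpha> * ln (real N) * ?s" using s by simp
  also have "\<dots> \<le> \<alpha> * ?\<theta> + ?\<theta> / 2 * ?s" using big(1) s by (intro add_left_mono mult_right_mono) auto
  finally have "?\<theta> * ?s \<le> ?\<theta> * (2 * \<alpha>)" by (simp add: algebra_simps)
  then show ?thesis using big(2) by simp
qed

text \<open>The weight of the primes above \<open>Y\<close> forces \<open>\<Sum>ln p\<close> to be
  at least \<open>2 * \<alpha> * ln N\<close>, so the larger sieve leaves at most
  \<open>2 * \<alpha>\<close> points. A single point then already is a positive proportion of
  \<open>S\<close>; it serves as both \<open>S'\<close> and \<open>A\<close>, with every class
  allowed.\<close>

lemma capturable_0:
  fixes \<alpha> \<kappa> :: real
  assumes S: "S \<subseteq> grid N d" "S \<noteq> {}" and N: "N \<ge> 2" and pos: "\<alpha> > 0" "\<kappa> > 0" "Y > 0"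
    and P: "finite P" "\<And>p. p \<in> P \<Longrightarrow> prime p"
    and W: "\<kappa> * ln (real N) \<le> wP P"
    and cl: "\<And>p. p \<in> P \<Longrightarrow> real (card (res p ` S)) \<le> \<alpha>"
    and Y: "4 * \<alpha> / \<kappa> \<le> real Y" "2 * real Y \<le> \<kappa> * ln (real N)"
  shows "capturable N d 0 D P (1 / (2 * \<alpha>)) 1 1 1 S"
proof -
  have lnp: "0 \<le> ln (real p)" if "p \<in> P" for p using P(2)[OF that] by (rule ln_prime_nonneg)
  have lnN: "ln (real N) > 0" using N by simp
  let ?A = "{p\<in>P. p \<le> Y}" and ?B = "{p\<in>P. p > Y}"
  have "wP P \<le> wP (?A \<union> ?B)" using P by (intro wP_mono) auto
  also have "\<dots> \<le> wP ?A + wP ?B" using P by (intro wP_Un_le) auto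
  also have "wP ?A \<le> real Y" using P by (intro wP_small_primes_le) auto
  also have "wP ?B \<le> (\<Sum>p\<in>?B. ln (real p) / real Y)"
    unfolding wP_def using lnp pos by (intro sum_mono divide_left_mono) auto
  also have "\<dots> \<le> (\<Sum>p\<in>P. ln (real p) / real Y)" using P lnp by (intro sum_mono2) auto
  also have "\<dots> = (\<Sum>p\<in>P. ln (real p)) / real Y" by (simp add: sum_divide_distrib)
  finally have "\<kappa> * ln (real N) / 2 \<le> (\<Sum>p\<in>P. ln (real p)) / real Y" using W Y(2) by linarith
  then have \<theta>: "real Y * (\<kappa> * ln (real N) / 2) \<le> (\<Sum>p\<in>P. ln (real p))" using pos by (simp add: field_simps)
  have "4 * \<alpha> \<le> real Y * \<kappa>" using Y(1) pos by (simp add: field_simps)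
  then have "4 * \<alpha> * (ln (real N) / 2) \<le> real Y * \<kappa> * (ln (real N) / 2)"
    using lnN by (intro mult_right_mono) auto
  then have \<theta>': "2 * \<alpha> * ln (real N) \<le> (\<Sum>p\<in>P. ln (real p))" using \<theta> by (simp add: mult_ac)
  moreover have "0 < 2 * \<alpha> * ln (real N)" using pos lnN by simp
  ultimately have cS: "real (card S) \<le> 2 * \<alpha>"
    using N by (intro larger_sieve[OF S _ pos(1) P cl]) auto
  obtain a where a: "a \<in> S" using S by auto
  show ?thesis unfolding capturable_def
  proof (intro exI conjI)
    show "{a} \<subseteq> S" "{a} \<subseteq> S" using a by auto
    show "1 / (2 * \<alpha>) * real (card S) \<le> real (card {a})" using cS pos by simp
    show "\<forall>p\<in>P. \<forall>y. real (card {z\<in>{a}. z \<in> UNIV \<and> res p z = res p y}) \<le> 1 * real (card {a}) / real p ^ 0"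
    proof (intro ballI allI)
      fix p y
      show "real (card {z\<in>{a}. z \<in> UNIV \<and> res p z = res p y}) \<le> 1 * real (card {a}) / real p ^ 0"
        using card_mono[OF finite.insertI[OF finite.emptyI] Collect_restrict[of "{a}" "\<lambda>z. z \<in> UNIV \<and> res p z = res p y"]]
        by simp
    qed
  qed auto
qed

text \<open>An average is turned into a pointwise bound. A point off the chosen sections has
  covering primes of total log at most \<open>m * ln N\<close>, since each section accounts for at
  most \<open>ln N\<close>. The points on the chosen sections can exceed this, but are few by
  \<open>light\<close>. They and the points covered by at most \<open>D * ln N\<close> each account
  for at most \<open>m * \<mu> / 8\<close> of the available \<open>m * \<mu> / 2\<close>; the rest,
  \<open>m * \<mu> / 4\<close>, forces many well covered points.\<close>

lemma covered_positive_proportion: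
  fixes P :: "nat set" and \<tau> \<mu> :: real
  assumes finS: "finite S" and X: "X \<subseteq> S" and Z: "finite Z" "card Z \<le> m" and m: "m > 0" and N: "N \<ge> 2"
    and grid: "S \<subseteq> grid N d" "i < d" "\<And>t. t \<in> Z \<Longrightarrow> 0 \<le> t \<and> t \<le> int N"
    and P: "finite P" "\<And>p. p \<in> P \<Longrightarrow> prime p"
    and C: "\<And>x. x \<in> X \<Longrightarrow> C x \<subseteq> {p\<in>P. \<exists>t\<in>Z. x i mod int p = t mod int p}"
    and lower: "real m * (\<mu> * ln (real N) * real (card X)) / 2 \<le> (\<Sum>x\<in>X. \<Sum>p\<in>C x. ln (real p))"
    and light: "\<And>t. t \<in> Z \<Longrightarrow> real (card {x\<in>S. x i = t}) * (\<Sum>p\<in>P. ln (real p)) \<le> \<mu> / 8 * real (card X) * ln (real N)"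
    and D: "real D \<le> real m * \<mu> / 8"
  shows "\<mu> / 4 * real (card X) \<le> real (card {x\<in>X. real D * ln (real N) < (\<Sum>p\<in>C x. ln (real p))})"
proof -
  let ?V = "{x\<in>X. real D * ln (real N) < (\<Sum>p\<in>C x. ln (real p))}"
  let ?\<theta> = "\<Sum>p\<in>P. ln (real p)"
  have finX: "finite X" using X finS finite_subset by blast
  have lnp: "0 \<le> ln (real p)" if "p \<in> P" for p using P(2)[OF that] by (rule ln_prime_nonneg)
  have lnN: "ln (real N) > 0" using N by simp
  have \<theta>: "?\<theta> \<ge> 0" using lnp by (intro sum_nonneg)
  have pt: "(\<Sum>p\<in>C x. ln (real p)) \<le> real D * ln (real N) + (if x \<in> ?V then real m * ln (real N) else 0)
      + (if x i \<in> Z then ?\<theta> else 0)" if x: "x \<in> X" for x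
  proof -
    have D0: "real D * ln (real N) \<ge> 0" "real m * ln (real N) \<ge> 0" using lnN by auto
    have CP: "C x \<subseteq> P" using C[OF x] by auto
    show ?thesis
    proof (cases "x i \<in> Z")
      case True
      have "(\<Sum>p\<in>C x. ln (real p)) \<le> ?\<theta>" using CP P lnp by (intro sum_mono2) auto
      then show ?thesis using True D0 by simp
    next
      case False
      have xr: "0 \<le> x i" "x i \<le> int N" using x X grid by (auto simp: grid_def)
      have "(\<Sum>p\<in>C x. ln (real p)) \<le> (\<Sum>p\<in>(\<Union>t\<in>Z. {p\<in>P. x i mod int p = t mod int p}). ln (real p))"
        using C[OF x] P lnp Z by (intro sum_mono2) auto
      also have "\<dots> \<le> (\<Sum>t\<in>Z. \<Sum>p\<in>{p\<in>P. x i mod int p = t mod int p}. ln (real p))"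
        using Z P lnp by (intro sum_UN_le) auto
      also have "\<dots> \<le> (\<Sum>t\<in>Z. ln (real N))"
        using False grid(3) xr by (intro sum_mono sum_ln_diff_le P) auto
      also have "\<dots> \<le> real m * ln (real N)" using Z(2) lnN by simp
      finally show ?thesis using False D0 x by auto
    qed
  qed
  have near: "real (card {x\<in>X. x i \<in> Z}) * ?\<theta> \<le> real m * (\<mu> / 8 * real (card X) * ln (real N))"
  proof -
    let ?q = "\<mu> / 8 * real (card X) * ln (real N)"
    have D': "0 \<le> real m * \<mu>" using D by linarith
    have q: "?q \<ge> 0" using lnN m D' by (simp add: zero_le_mult_iff)
    have "card {x\<in>X. x i \<in> Z} \<le> card (\<Union>t\<in>Z. {x\<in>S. x i = t})"
      using Z finS X by (intro card_mono) auto
    also have "\<dots> \<le> (\<Sum>t\<in>Z. card {x\<in>S. x i = t})" by (rule card_UN_le[OF Z(1)])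
    finally have "card {x\<in>X. x i \<in> Z} \<le> (\<Sum>t\<in>Z. card {x\<in>S. x i = t})" .
    then have "real (card {x\<in>X. x i \<in> Z}) \<le> real (\<Sum>t\<in>Z. card {x\<in>S. x i = t})" by (rule of_nat_mono)
    then have "real (card {x\<in>X. x i \<in> Z}) * ?\<theta> \<le> real (\<Sum>t\<in>Z. card {x\<in>S. x i = t}) * ?\<theta>"
      using \<theta> by (rule mult_right_mono)
    also have "\<dots> = (\<Sum>t\<in>Z. real (card {x\<in>S. x i = t}) * ?\<theta>)" by (simp add: sum_distrib_right)
    also have "\<dots> \<le> (\<Sum>t\<in>Z. ?q)" using light by (intro sum_mono) auto
    also have "\<dots> = real (card Z) * ?q" by simp
    also have "\<dots> \<le> real m * ?q" using Z(2) q by (intro mult_right_mono) auto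
    finally show ?thesis .
  qed
  have "real m * (\<mu> * ln (real N) * real (card X)) / 2
    \<le> (\<Sum>x\<in>X. real D * ln (real N) + (if x \<in> ?V then real m * ln (real N) else 0) + (if x i \<in> Z then ?\<theta> else 0))"
    using lower pt sum_mono by (meson order.trans)
  also have "\<dots> = real D * ln (real N) * real (card X) + real (card ?V) * (real m * ln (real N))
    + real (card {x\<in>X. x i \<in> Z}) * ?\<theta>"
  proof -
    have "(\<Sum>x\<in>X. if x \<in> ?V then real m * ln (real N) else 0) = real (card ?V) * (real m * ln (real N))"
      using finX by (subst sum.inter_filter[symmetric]) auto
    moreover have "(\<Sum>x\<in>X. if x i \<in> Z then ?\<theta> else 0) = real (card {x\<in>X. x i \<in> Z}) * ?\<theta>"
      using finX by (subst sum.inter_filter[symmetric]) auto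
    ultimately show ?thesis by (simp only: sum.distrib) simp
  qed
  also have "\<dots> \<le> (real m * \<mu> / 8) * ln (real N) * real (card X) + real (card ?V) * (real m * ln (real N))
    + real m * (\<mu> / 8 * real (card X) * ln (real N))"
    using D lnN near by (intro add_mono mult_right_mono) auto
  finally have "(real m * ln (real N)) * (\<mu> / 4 * real (card X)) \<le> (real m * ln (real N)) * real (card ?V)"
    by (simp add: algebra_simps)
  then show ?thesis using m lnN by (simp only: mult_le_cancel_left_pos[OF mult_pos_pos] of_nat_0_less_iff)
qed

text \<open>Selects the sections fit for the induction. Of the \<open>card S / (2 * d)\<close>
  points that are light in coordinate i, at most \<open>card S / (4 * d)\<close> lie in sections
  smaller than \<open>q\<close> and at most \<open>card S / (8 * d)\<close> in sections with too
  many bad primes. With \<open>b = 8 / \<kappa>\<close> the heavy primes have at most a quarter of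
  the weight of \<open>P\<close>, and \<open>L\<close> is chosen so that
  \<open>\<alpha> * b / L = 1 / (32 * d)\<close>; a good section thus keeps half of the
  weight.\<close>

lemma light_big_few_sections:
  fixes \<alpha> \<kappa> \<epsilon> \<theta>' c0 :: real and d k N :: nat
  defines "b \<equiv> 8 / \<kappa>"
  defines "L \<equiv> 32 * real d * \<alpha> * b"
  defines "q \<equiv> c0 / (8 * real d) * real N powr (real k - 1 + \<epsilon>)"
  assumes S: "S \<subseteq> grid N d" "S \<noteq> {}" and d: "d > 0" and N: "N \<ge> 2" and pos: "\<alpha> > 0" "\<kappa> > 0" "c0 > 0"
    and P: "finite P" "\<And>p. p \<in> P \<Longrightarrow> prime p"
    and W: "\<kappa> * ln (real N) \<le> wP P"
    and size: "c0 * real N powr (real k + \<epsilon>) \<le> real (card S)"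
    and big: "(real N powr \<theta>') ^ d \<le> real (card S) / 2"
    and lnP: "(\<Sum>p\<in>P. ln (real p)) \<le> real N powr \<theta>' * ln (real N)"
    and cl: "\<And>p. p \<in> P \<Longrightarrow> real (card (res p ` S)) \<le> \<alpha> * real p ^ Suc k"
  obtains i T Pt where "i < d" "T \<subseteq> (\<lambda>x. x i) ` S"
    "real (card S) / (8 * real d) \<le> real (card {x\<in>S. x i \<in> T})"
    "\<And>t. t \<in> T \<Longrightarrow> real (card {x\<in>S. x i = t}) \<le> real N powr (- \<theta>') * real (card S)"
    "\<And>t. t \<in> T \<Longrightarrow> q \<le> real (card {x\<in>S. x i = t})"
    "\<And>t. t \<in> T \<Longrightarrow> Pt t \<subseteq> P"
    "\<And>t. t \<in> T \<Longrightarrow> wP P / 2 \<le> wP (Pt t)"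
    "\<And>t p. t \<in> T \<Longrightarrow> p \<in> Pt t \<Longrightarrow> real (card (res p ` {x\<in>S. x i = t})) \<le> L * real p ^ k"
    "\<And>t p. t \<in> T \<Longrightarrow> p \<in> Pt t \<Longrightarrow> real (card {x\<in>S. x i mod int p = t mod int p}) \<le> b * real (card S) / real p"
proof -
  have fin: "finite S" using S finite_grid finite_subset by blast
  have cS: "real (card S) > 0" using S fin by (simp add: card_gt_0_iff)
  have lnN: "ln (real N) > 0" using N by simp
  have W0: "wP P > 0" using W pos lnN by (smt (verit) mult_pos_pos)
  have b: "b > 0" and L: "L > 0" using pos d by (auto simp: b_def L_def)
  have Np: "real N powr \<theta>' > 0" using N by simp
  define \<sigma> where "\<sigma> = real N powr (- \<theta>')"
  have \<sigma>: "\<sigma> > 0" using N by (simp add: \<sigma>_def)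
  have \<sigma>': "1 / \<sigma> = real N powr \<theta>'" using N by (simp add: \<sigma>_def powr_minus field_simps)
  obtain i where i: "i < d" and light:
    "real (card S) / (2 * real d) \<le> real (card {x\<in>S. real (card {y\<in>S. y i = x i}) < \<sigma> * real (card S)})"
    using light_coordinate[OF S(1) \<sigma> d] big \<sigma>' by auto
  define n where "n t = real (card {y\<in>S. y i = t})" for t
  define heavy where "heavy t p \<longleftrightarrow> b * real (card S) / real p < real (card {x\<in>S. x i mod int p = t mod int p})" for t p
  \<comment> \<open>Badness concerns the whole fibre modulo p, which contains the section; only this
    makes \<open>crowded_residues_card_le\<close> applicable.\<close>
  define bad where "bad t p \<longleftrightarrow> L * real p ^ k < real (card (res p ` {x\<in>S. x i mod int p = t mod int p}))
     \<and> real (card {x\<in>S. x i mod int p = t mod int p}) \<le> b * real (card S) / real p" for t p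
  define Pt where "Pt t = {p\<in>P. \<not> heavy t p \<and> \<not> bad t p}" for t
  define w where "w t = wP {p\<in>P. bad t p}" for t
  let ?L = "{x\<in>S. n (x i) < \<sigma> * real (card S)}"
  let ?M = "{x\<in>S. n (x i) < q}"
  let ?B = "{x\<in>S. w (x i) > wP P / 4}"
  define T where "T = (\<lambda>x. x i) ` (?L - ?M - ?B)"
  have range: "0 \<le> x i \<and> x i \<le> int N" if "x \<in> S" for x using that S i by (auto simp: grid_def)

  \<comment> \<open>There are \<open>N + 1 \<le> 2 * N\<close> possible values of the coordinate,
    each with fewer than \<open>q\<close> points.\<close>
  have cM: "real (card ?M) \<le> real (card S) / (4 * real d)"
  proof -
    let ?U = "{t\<in>{0..int N}. n t < q}"
    have finU: "finite ?U" by (rule finite_subset[of _ "{0..int N}"]) auto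
    have "card ?M \<le> card (\<Union>t\<in>?U. {y\<in>S. y i = t})"
      using fin range by (intro card_mono finite_UN_I[OF finU]) auto
    also have "\<dots> \<le> (\<Sum>t\<in>?U. card {y\<in>S. y i = t})" by (rule card_UN_le[OF finU])
    finally have "card ?M \<le> (\<Sum>t\<in>?U. card {y\<in>S. y i = t})" .
    then have "real (card ?M) \<le> real (\<Sum>t\<in>?U. card {y\<in>S. y i = t})" by (rule of_nat_mono)
    also have "\<dots> = (\<Sum>t\<in>?U. n t)" by (simp add: n_def)
    also have "\<dots> \<le> (\<Sum>t\<in>?U. q)" by (intro sum_mono) auto
    also have "\<dots> = real (card ?U) * q" by simp
    also have "\<dots> \<le> (2 * real N) * q"
    proof (rule mult_right_mono)
      have "card ?U \<le> card {0..int N}" by (intro card_mono) auto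
      then show "real (card ?U) \<le> 2 * real N" using N by simp
      show "0 \<le> q" using pos by (simp add: q_def)
    qed
    also have "\<dots> = (c0 * (real N powr 1 * real N powr (real k - 1 + \<epsilon>))) / (4 * real d)"
      using N by (simp add: q_def)
    also have "real N powr 1 * real N powr (real k - 1 + \<epsilon>) = real N powr (real k + \<epsilon>)"
      by (subst powr_add[symmetric]) simp
    also have "c0 * real N powr (real k + \<epsilon>) / (4 * real d) \<le> real (card S) / (4 * real d)"
      using size by (intro divide_right_mono) auto
    finally show ?thesis .
  qed

  have cB: "real (card ?B) \<le> real (card S) / (8 * real d)"
  proof -
    have "(\<Sum>x\<in>S. w (x i)) = (\<Sum>p\<in>P. ln (real p) / real p * real (card {x\<in>S. bad (x i) p}))"
      unfolding w_def wP_def by (rule sum_card_swap[OF P(1) fin, symmetric])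
    also have "\<dots> \<le> (\<Sum>p\<in>P. ln (real p) / real p * (\<alpha> * b / L * real (card S)))"
    proof (intro sum_mono mult_left_mono)
      fix p assume p: "p \<in> P"
      show "real (card {x\<in>S. bad (x i) p}) \<le> \<alpha> * b / L * real (card S)"
        unfolding bad_def using crowded_residues_card_le[OF fin _ L b cl[OF p]] prime_gt_0_nat[OF P(2)[OF p]] by simp
      show "0 \<le> ln (real p) / real p" using ln_prime_nonneg[OF P(2)[OF p]] by simp
    qed
    also have "\<dots> = wP P * (\<alpha> * b / L * real (card S))" unfolding wP_def sum_distrib_right ..
    also have "\<alpha> * b / L = 1 / (32 * real d)" using pos b by (simp add: L_def)
    finally have "wP P / 4 * real (card ?B) \<le> wP P * (1 / (32 * real d) * real (card S))"
      using fin P by (intro card_markov) (auto simp: w_def intro!: wP_nonneg)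
    then have "wP P * (real (card ?B) / 4) \<le> wP P * (real (card S) / (32 * real d))" by simp
    then have "real (card ?B) / 4 \<le> real (card S) / (32 * real d)" using W0 by (simp only: mult_le_cancel_left_pos)
    then show ?thesis by simp
  qed

  show thesis
  proof (rule that[of i T Pt, OF i])
    show "T \<subseteq> (\<lambda>x. x i) ` S" by (auto simp: T_def)
    show "real (card S) / (8 * real d) \<le> real (card {x\<in>S. x i \<in> T})"
    proof -
      have "?L - ?M - ?B \<subseteq> {x\<in>S. x i \<in> T}" by (auto simp: T_def)
      then have "?L \<subseteq> {x\<in>S. x i \<in> T} \<union> ?M \<union> ?B" by blast
      then have "card ?L \<le> card ({x\<in>S. x i \<in> T} \<union> ?M \<union> ?B)" using fin by (intro card_mono) auto
      also have "\<dots> \<le> card {x\<in>S. x i \<in> T} + card ?M + card ?B"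
        by (rule order.trans[OF card_Un_le add_right_mono[OF card_Un_le]])
      finally have "real (card ?L) \<le> real (card {x\<in>S. x i \<in> T}) + real (card ?M) + real (card ?B)" by linarith
      moreover have "real (card S) / (2 * real d) = 4 * (real (card S) / (8 * real d))"
        "real (card S) / (4 * real d) = 2 * (real (card S) / (8 * real d))" by auto
      ultimately show ?thesis using light cM cB unfolding n_def by linarith
    qed
    fix t assume t: "t \<in> T"
    then obtain x where "x \<in> ?L - ?M - ?B" "x i = t" unfolding T_def by blast
    then have x: "x \<in> S" "x i = t" and nt: "n t < \<sigma> * real (card S)" "q \<le> n t" "w t \<le> wP P / 4"
      by (auto simp: not_less)
    show "real (card {x\<in>S. x i = t}) \<le> real N powr (- \<theta>') * real (card S)"
      using nt by (simp add: n_def \<sigma>_def)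
    show "q \<le> real (card {x\<in>S. x i = t})" using nt by (simp add: n_def)
    show "Pt t \<subseteq> P" by (auto simp: Pt_def)
    \<comment> \<open>Lightness of the section balances the crude bound on the total log of the
      primes; this is the hypothesis needed by \<open>heavy_primes_weight_le\<close>.\<close>
    have "n t * (\<Sum>p\<in>P. ln (real p)) \<le> (\<sigma> * real (card S)) * (real N powr \<theta>' * ln (real N))"
      using nt(1) lnP ln_prime_nonneg P by (intro mult_mono) (auto intro!: sum_nonneg simp: \<sigma>_def)
    also have "\<dots> = real (card S) * ln (real N)" using \<sigma>' \<sigma> by (simp add: field_simps)
    finally have lt: "n t * (\<Sum>p\<in>P. ln (real p)) \<le> real (card S) * ln (real N)" .
    have "wP {p\<in>P. heavy t p} \<le> 2 * ln (real N) / b"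
      unfolding heavy_def using lt range[OF x(1)] x(2) N b
      by (intro heavy_primes_weight_le[OF S i _ _ P]) (auto simp: n_def)
    also have "\<dots> = \<kappa> * ln (real N) / 4" using pos by (simp add: b_def)
    finally have hv: "wP {p\<in>P. heavy t p} \<le> wP P / 4" using W by linarith
    have "wP P \<le> wP (Pt t \<union> ({p\<in>P. heavy t p} \<union> {p\<in>P. bad t p}))"
      using P by (intro wP_mono) (auto simp: Pt_def)
    also have "\<dots> \<le> wP (Pt t) + (wP {p\<in>P. heavy t p} + wP {p\<in>P. bad t p})"
      using P by (intro order.trans[OF wP_Un_le add_left_mono] wP_Un_le) (auto simp: Pt_def)
    finally show "wP P / 2 \<le> wP (Pt t)" using hv nt(3) by (simp add: w_def)
    fix p assume p: "p \<in> Pt t"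
    then show h: "real (card {x\<in>S. x i mod int p = t mod int p}) \<le> b * real (card S) / real p"
      by (auto simp: Pt_def heavy_def)
    have "card (res p ` {x\<in>S. x i = t}) \<le> card (res p ` {x\<in>S. x i mod int p = t mod int p})"
      using fin by (intro card_mono image_mono) auto
    also have "real \<dots> \<le> L * real p ^ k" using p h by (auto simp: Pt_def bad_def)
    finally show "real (card (res p ` {x\<in>S. x i = t})) \<le> L * real p ^ k" by simp
  qed
qed

text \<open>Each good section is captured by the induction hypothesis with its own primes
  \<open>Pt t\<close>, and at most \<open>K1 * D\<close> of the sections are chosen to cover a
  positive proportion \<open>V\<close>. A function vanishing on the sets \<open>A t\<close> vanishes
  on the chosen pieces, hence at a point of \<open>V\<close> is divisible by primes with product
  above \<open>N ^ D\<close>. The number of chosen sections supplies the extra factor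
  \<open>D\<close> in the size of the characteristic subset.\<close>

lemma capturable_Suc:
  fixes \<alpha> \<kappa> \<epsilon> \<theta>' c0 \<delta>0 \<beta>0 c1 :: real and d k N D Y K0 K1 :: nat
  defines "b \<equiv> 8 / \<kappa>"
  defines "L \<equiv> 32 * real d * \<alpha> * b"
  defines "\<delta>1 \<equiv> \<delta>0 / (8 * real d)"
  defines "\<mu> \<equiv> (c1 / 4)\<^sup>2 / (\<alpha> * \<beta>0) * \<kappa>"
  defines "\<delta> \<equiv> \<mu> / 4 * \<delta>1"
  assumes S: "S \<subseteq> grid N d" "S \<noteq> {}" and d: "d > 0" and N: "N \<ge> 2" and D: "D > 0"
    and pos: "\<alpha> > 0" "\<kappa> > 0" "c0 > 0" "\<delta>0 > 0" "\<beta>0 > 0" "c1 > 0" "Y > 0"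
    and P: "finite P" "\<And>p. p \<in> P \<Longrightarrow> prime p"
    and W: "\<kappa> * ln (real N) \<le> wP P"
    and size: "c0 * real N powr (real k + \<epsilon>) \<le> real (card S)"
    and big: "(real N powr \<theta>') ^ d \<le> real (card S) / 2"
    and lnP: "(\<Sum>p\<in>P. ln (real p)) \<le> min 1 (\<mu> / 8 * \<delta>1) * (real N powr \<theta>' * ln (real N))"
    and cl: "\<And>p. p \<in> P \<Longrightarrow> real (card (res p ` S)) \<le> \<alpha> * real p ^ Suc k"
    and K1: "8 / \<mu> \<le> real K1"
    and Y: "real Y \<le> c1 / 4 * (\<kappa> * ln (real N))"
      "b\<^sup>2 / (\<delta>1\<^sup>2 * real Y) \<le> (c1 / 4)\<^sup>2 / (\<alpha> * \<beta>0) / (2 * real (K1 * D))"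
    and IH: "\<And>S0 P0. P0 \<subseteq> P \<Longrightarrow> \<kappa> / 2 * ln (real N) \<le> wP P0 \<Longrightarrow> S0 \<subseteq> grid N d \<Longrightarrow>
      c0 / (8 * real d) * real N powr (real k - 1 + \<epsilon>) \<le> real (card S0) \<Longrightarrow>
      (\<forall>p\<in>P0. real (card (res p ` S0)) \<le> L * real p ^ k) \<Longrightarrow> capturable N d k D P0 \<delta>0 \<beta>0 c1 K0 S0"
  shows "capturable N d (Suc k) D P \<delta> (\<beta>0 * b / \<delta>) (c1 / 2) (K0 * K1) S"
proof -
  have fin: "finite S" using S finite_grid finite_subset by blast
  have cS: "real (card S) > 0" using S fin by (simp add: card_gt_0_iff)
  have lnN: "ln (real N) > 0" using N by simp
  have b: "b > 0" using pos by (simp add: b_def)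
  have \<delta>1: "\<delta>1 > 0" using pos d by (simp add: \<delta>1_def)
  have \<mu>: "\<mu> > 0" using pos by (simp add: \<mu>_def)
  have \<delta>: "\<delta> > 0" using \<mu> \<delta>1 by (simp add: \<delta>_def)
  have "real K1 > 0" using K1 \<mu> by (smt (verit) divide_pos_pos)
  then have K1': "K1 > 0" by simp
  have Nl: "real N powr \<theta>' * ln (real N) > 0" using N lnN by simp
  have "min 1 (\<mu> / 8 * \<delta>1) * (real N powr \<theta>' * ln (real N)) \<le> 1 * (real N powr \<theta>' * ln (real N))"
    using Nl by (intro mult_right_mono) auto
  then have lnP': "(\<Sum>p\<in>P. ln (real p)) \<le> real N powr \<theta>' * ln (real N)" using lnP by linarith
  obtain i T Pt where i: "i < d" and T: "T \<subseteq> (\<lambda>x. x i) ` S"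
    and Tbig: "real (card S) / (8 * real d) \<le> real (card {x\<in>S. x i \<in> T})"
    and light: "\<And>t. t \<in> T \<Longrightarrow> real (card {x\<in>S. x i = t}) \<le> real N powr (- \<theta>') * real (card S)"
    and secbig: "\<And>t. t \<in> T \<Longrightarrow> c0 / (8 * real d) * real N powr (real k - 1 + \<epsilon>) \<le> real (card {x\<in>S. x i = t})"
    and Pt: "\<And>t. t \<in> T \<Longrightarrow> Pt t \<subseteq> P"
    and wPt: "\<And>t. t \<in> T \<Longrightarrow> wP P / 2 \<le> wP (Pt t)"
    and seccl: "\<And>t p. t \<in> T \<Longrightarrow> p \<in> Pt t \<Longrightarrow> real (card (res p ` {x\<in>S. x i = t})) \<le> L * real p ^ k"
    and nonheavy: "\<And>t p. t \<in> T \<Longrightarrow> p \<in> Pt t \<Longrightarrow>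
      real (card {x\<in>S. x i mod int p = t mod int p}) \<le> b * real (card S) / real p"
    using light_big_few_sections[OF S d N pos(1-3) P W size big lnP' cl] unfolding b_def L_def by blast
  have finT: "finite T" using T fin finite_surj by blast
  have Trange: "0 \<le> t \<and> t \<le> int N" if "t \<in> T" for t using that T S i by (fastforce simp: grid_def)

  have "\<forall>t\<in>T. capturable N d k D (Pt t) \<delta>0 \<beta>0 c1 K0 {x\<in>S. x i = t}"
  proof
    fix t assume t: "t \<in> T"
    show "capturable N d k D (Pt t) \<delta>0 \<beta>0 c1 K0 {x\<in>S. x i = t}"
    proof (rule IH)
      show "\<kappa> / 2 * ln (real N) \<le> wP (Pt t)" using wPt[OF t] W by simp
    qed (use t Pt S secbig seccl in auto)
  qed
  \<comment> \<open>The body of \<open>capturable\<close>, with the three witnesses as arguments, so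
    that \<open>bchoice\<close> can select them for all sections at once.\<close>
  moreover define Q where "Q t S' A G \<longleftrightarrow> S' \<subseteq> {x\<in>S. x i = t} \<and> A \<subseteq> {x\<in>S. x i = t} \<and>
     \<delta>0 * real (card {x\<in>S. x i = t}) \<le> real (card (S')) \<and> card (A) \<le> K0 * D ^ k \<and>
     (\<forall>f. cong_preserving f \<longrightarrow> (\<forall>x\<in>grid N d. \<bar>f x\<bar> \<le> int N ^ D) \<longrightarrow> (\<forall>x\<in>A. f x = 0)
        \<longrightarrow> (\<forall>x\<in>S'. f x = 0)) \<and>
     (\<forall>p\<in>Pt t. \<forall>y. real (card {z\<in>S'. z \<in> G p \<and> res p z = res p y}) \<le> \<beta>0 * real (card (S')) / real p ^ k) \<and>
     (\<forall>x\<in>S'. c1 * wP (Pt t) \<le> wP {p\<in>Pt t. x \<in> G p})" for t S' A G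
  ultimately have "\<forall>t\<in>T. \<exists>z. Q t (fst z) (fst (snd z)) (snd (snd z))"
  proof (intro ballI)
    fix t assume cap: "\<forall>t\<in>T. capturable N d k D (Pt t) \<delta>0 \<beta>0 c1 K0 {x\<in>S. x i = t}" and t: "t \<in> T"
    have "\<exists>S' A G. Q t S' A G"
      using bspec[OF cap t] unfolding capturable_def Q_def Bex_def by (elim exE conjE) (intro exI conjI; assumption)
    then obtain S' A G where "Q t S' A G" by blast
    then show "\<exists>z. Q t (fst z) (fst (snd z)) (snd (snd z))" by (intro exI[of _ "(S', A, G)"]) simp
  qed
  from bchoice[OF this] obtain z where z: "\<forall>t\<in>T. Q t (fst (z t)) (fst (snd (z t))) (snd (snd (z t)))" ..
  define S' A G where "S' t = fst (z t)" and "A t = fst (snd (z t))" and "G t = snd (snd (z t))" for t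
  have "\<forall>t\<in>T. Q t (S' t) (A t) (G t)" using z by (simp add: S'_def A_def G_def)
  then have sub: "\<And>t. t \<in> T \<Longrightarrow> S' t \<subseteq> {x\<in>S. x i = t}"
    and A: "\<And>t. t \<in> T \<Longrightarrow> A t \<subseteq> S" "\<And>t. t \<in> T \<Longrightarrow> card (A t) \<le> K0 * D ^ k"
    and S'big: "\<And>t. t \<in> T \<Longrightarrow> \<delta>0 * real (card {x\<in>S. x i = t}) \<le> real (card (S' t))"
    and vanish: "\<And>t f. t \<in> T \<Longrightarrow> cong_preserving f \<Longrightarrow> (\<forall>x\<in>grid N d. \<bar>f x\<bar> \<le> int N ^ D) \<Longrightarrow>
       (\<forall>x\<in>A t. f x = 0) \<Longrightarrow> (\<forall>x\<in>S' t. f x = 0)"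
    and few: "\<And>t p y. t \<in> T \<Longrightarrow> p \<in> Pt t \<Longrightarrow>
      real (card {z\<in>S' t. z \<in> G t p \<and> res p z = res p y}) \<le> \<beta>0 * real (card (S' t)) / real p ^ k"
    and wt0: "\<And>t x. t \<in> T \<Longrightarrow> x \<in> S' t \<Longrightarrow> c1 * wP (Pt t) \<le> wP {p\<in>Pt t. x \<in> G t p}"
    unfolding Q_def by blast+
  \<comment> \<open>The factor 1/2 lost here is why \<open>section_cover\<close> is applied with
    \<open>c1 / 2\<close>, and why \<open>c1 / 4\<close> enters \<open>\<mu>\<close>.\<close>
  have wt: "c1 / 2 * wP P \<le> wP {p\<in>Pt t. x \<in> G t p}" if "t \<in> T" "x \<in> S' t" for t x
  proof -
    have "c1 * (wP P / 2) \<le> c1 * wP (Pt t)" using wPt[OF that(1)] pos by (intro mult_left_mono) auto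
    then show ?thesis using wt0[OF that] by simp
  qed
  have finS': "finite (S' t)" if "t \<in> T" for t using sub[OF that] fin finite_subset[of "S' t" S] by auto
  define X where "X = (\<Union>t\<in>T. S' t)"
  have XS: "X \<subseteq> S" using sub by (auto simp: X_def)
  have finX: "finite X" using XS fin finite_subset by blast
  have Xt: "x i \<in> T" "x \<in> S' (x i)" if "x \<in> X" for x using that sub by (fastforce simp: X_def)+
  have cX: "\<delta>1 * real (card S) \<le> real (card X)"
  proof -
    have "{x\<in>S. x i \<in> T} = (\<Union>t\<in>T. {x\<in>S. x i = t})" by auto
    then have "card {x\<in>S. x i \<in> T} = (\<Sum>t\<in>T. card {x\<in>S. x i = t})"
      using finT fin by (simp only:) (subst card_UN_disjoint; auto)
    moreover have "card X = (\<Sum>t\<in>T. card (S' t))"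
    proof -
      have "S' t \<inter> S' t' = {}" if "t \<in> T" "t' \<in> T" "t \<noteq> t'" for t t'
        using sub[OF that(1)] sub[OF that(2)] that(3) by blast
      then show ?thesis unfolding X_def using finT finS' by (intro card_UN_disjoint) auto
    qed
    ultimately have "\<delta>0 * real (card {x\<in>S. x i \<in> T}) \<le> real (card X)"
      using S'big by (auto simp: sum_distrib_left intro!: sum_mono)
    moreover have "\<delta>0 * (real (card S) / (8 * real d)) \<le> \<delta>0 * real (card {x\<in>S. x i \<in> T})"
      using Tbig pos by (intro mult_left_mono) auto
    ultimately show ?thesis by (simp add: \<delta>1_def)
  qed
  have "\<delta>1 * real (card S) > 0" using \<delta>1 cS by simp
  then have cX0: "real (card X) > 0" using cX by linarith
  then have Xne: "X \<noteq> {}" by auto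
  let ?m = "K1 * D"
  have m: "?m > 0" using K1' D by simp

  obtain Z where Z: "Z \<subseteq> T" "card Z \<le> ?m" and cov: "real ?m * ((c1 / 2 / 2)\<^sup>2 / (\<alpha> * \<beta>0) * wP P * real (card X)) / 2
    \<le> (\<Sum>x\<in>X. \<Sum>p\<in>{p\<in>P. \<exists>t\<in>Z. p \<in> Pt t \<and> res p x \<in> res p ` S' t}. ln (real p))"
  proof -
    have "\<exists>Z\<subseteq>T. card Z \<le> ?m \<and> real ?m * ((c1 / 2 / 2)\<^sup>2 / (\<alpha> * \<beta>0) * wP P * real (card X)) / 2
    \<le> (\<Sum>x\<in>X. \<Sum>p\<in>{p\<in>P. \<exists>t\<in>Z. p \<in> Pt t \<and> res p x \<in> res p ` S' t}. ln (real p))"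
      unfolding X_def
    proof (rule section_cover[where S = S and G = G and i = i and b = b and \<delta> = \<delta>1 and Y = Y and k = k])
      have "c1 / 4 * (\<kappa> * ln (real N)) \<le> c1 / 4 * wP P" using W pos by (intro mult_left_mono) auto
      then show "real Y \<le> c1 / 2 / 2 * wP P" using Y(1) by simp
      show "b\<^sup>2 / (\<delta>1\<^sup>2 * real Y) \<le> (c1 / 2 / 2)\<^sup>2 / (\<alpha> * \<beta>0) / (2 * real ?m)" using Y(2) by simp
    qed (use fin finT sub P Pt cl few nonheavy wt pos b \<delta>1 m Xne cX in \<open>auto simp: X_def\<close>)
    with that show ?thesis by blast
  qed
  have finZ: "finite Z" using Z(1) finT finite_subset by blast
  define C where "C x = {p\<in>P. \<exists>t\<in>Z. p \<in> Pt t \<and> res p x \<in> res p ` S' t}" for x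
  \<comment> \<open>The threshold is the logarithm of the size bound \<open>N ^ D\<close>: beyond
    it, divisibility by the covering primes forces the value 0.\<close>
  define V where "V = {x\<in>X. real D * ln (real N) < (\<Sum>p\<in>C x. ln (real p))}"
  have VX: "V \<subseteq> X" by (auto simp: V_def)

  have cV: "\<mu> / 4 * real (card X) \<le> real (card V)"
    unfolding V_def
  proof (rule covered_positive_proportion[OF fin XS finZ Z(2) m N S(1) i _ P])
    show "0 \<le> t \<and> t \<le> int N" if "t \<in> Z" for t using that Z(1) Trange by blast
    show "C x \<subseteq> {p\<in>P. \<exists>t\<in>Z. x i mod int p = t mod int p}" for x
    proof
      fix p assume "p \<in> C x"
      then obtain t z where t: "p \<in> P" "t \<in> Z" "z \<in> S' t" "res p x = res p z" by (auto simp: C_def)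
      then have "z i = t" using sub Z(1) by blast
      with t have "x i mod int p = t mod int p" unfolding res_def by metis
      with t show "p \<in> {p\<in>P. \<exists>t\<in>Z. x i mod int p = t mod int p}" by blast
    qed
    have "real ?m * (\<mu> * ln (real N) * real (card X)) / 2
      = real ?m * (((c1 / 2 / 2)\<^sup>2 / (\<alpha> * \<beta>0)) * (\<kappa> * ln (real N)) * real (card X)) / 2"
      by (simp add: \<mu>_def)
    also have "\<dots> \<le> real ?m * ((c1 / 2 / 2)\<^sup>2 / (\<alpha> * \<beta>0) * wP P * real (card X)) / 2"
      using W pos by (intro divide_right_mono mult_left_mono mult_right_mono) auto
    also note cov
    finally show "real ?m * (\<mu> * ln (real N) * real (card X)) / 2 \<le> (\<Sum>x\<in>X. \<Sum>p\<in>C x. ln (real p))"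
      by (simp add: C_def)
    show "real (card {x\<in>S. x i = t}) * (\<Sum>p\<in>P. ln (real p)) \<le> \<mu> / 8 * real (card X) * ln (real N)"
      if "t \<in> Z" for t
    proof -
      \<comment> \<open>The second entry of the minimum makes the chosen sections negligible; the
        first entry was used for selecting them.\<close>
      have "(\<Sum>p\<in>P. ln (real p)) \<le> (\<mu> / 8 * \<delta>1) * (real N powr \<theta>' * ln (real N))"
        by (rule order.trans[OF lnP mult_right_mono[OF min.cobounded2]]) (use Nl in simp)
      then have "real (card {x\<in>S. x i = t}) * (\<Sum>p\<in>P. ln (real p))
        \<le> (real N powr (- \<theta>') * real (card S)) * ((\<mu> / 8 * \<delta>1) * (real N powr \<theta>' * ln (real N)))"
        using light that Z(1) ln_prime_nonneg P by (intro mult_mono) (auto intro!: sum_nonneg)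
      also have "\<dots> = (real N powr (- \<theta>') * real N powr \<theta>') * (\<mu> / 8 * ln (real N) * (\<delta>1 * real (card S)))"
        by (simp only: mult_ac)
      also have "real N powr (- \<theta>') * real N powr \<theta>' = 1" using N by (simp add: powr_minus)
      also have "1 * (\<mu> / 8 * ln (real N) * (\<delta>1 * real (card S))) \<le> 1 * (\<mu> / 8 * ln (real N) * real (card X))"
        using cX \<mu> lnN by (intro mult_left_mono) auto
      finally show ?thesis by (simp only: mult_ac)
    qed
    \<comment> \<open>The size of \<open>K1\<close> ensures that \<open>K1 * D\<close> sections
      provide enough covering to exceed the threshold \<open>D * ln N\<close> on average.\<close>
    have "8 \<le> real K1 * \<mu>" using K1 \<mu> by (simp add: pos_divide_le_eq)
    then have "8 * real D \<le> real K1 * \<mu> * real D" by (intro mult_right_mono) auto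
    then show "real D \<le> real ?m * \<mu> / 8" by (simp add: mult_ac)
  qed
  have cVS: "\<delta> * real (card S) \<le> real (card V)"
  proof -
    have "\<mu> / 4 * (\<delta>1 * real (card S)) \<le> \<mu> / 4 * real (card X)" using cX \<mu> by (intro mult_left_mono) auto
    then show ?thesis using cV by (simp add: \<delta>_def)
  qed
  define H where "H p = {x. p \<in> Pt (x i) \<and> x \<in> G (x i) p}" for p
  show ?thesis unfolding capturable_def
  proof (rule exI[of _ V], intro conjI, use VX XS in blast, rule exI[of _ "\<Union>t\<in>Z. A t"], intro conjI,
      use A(1) Z(1) in blast, rule exI[of _ H], intro conjI)
    show "\<delta> * real (card S) \<le> real (card V)" by (rule cVS)
    show "card (\<Union>t\<in>Z. A t) \<le> K0 * K1 * D ^ Suc k"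
    proof -
      have "card (\<Union>t\<in>Z. A t) \<le> (\<Sum>t\<in>Z. card (A t))" by (rule card_UN_le[OF finZ])
      also have "\<dots> \<le> (\<Sum>t\<in>Z. K0 * D ^ k)" using A(2) Z(1) by (intro sum_mono) auto
      also have "\<dots> = card Z * (K0 * D ^ k)" by simp
      also have "\<dots> \<le> ?m * (K0 * D ^ k)" using Z(2) by (rule mult_right_mono) simp
      finally show ?thesis by (simp add: mult_ac)
    qed
    show "\<forall>f. cong_preserving f \<longrightarrow> (\<forall>x\<in>grid N d. \<bar>f x\<bar> \<le> int N ^ D) \<longrightarrow> (\<forall>x\<in>\<Union>t\<in>Z. A t. f x = 0)
        \<longrightarrow> (\<forall>x\<in>V. f x = 0)"
    proof (intro allI impI ballI)
      fix f x assume f: "cong_preserving f" "\<forall>x\<in>grid N d. \<bar>f x\<bar> \<le> int N ^ D" "\<forall>x\<in>\<Union>t\<in>Z. A t. f x = 0"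
        and x: "x \<in> V"
      have f0: "f z = 0" if "t \<in> Z" "z \<in> S' t" for t z
        using vanish[of t f] f that Z(1) by blast
      show "f x = 0"
      proof (rule ccontr)
        assume nz: "f x \<noteq> 0"
        have xg: "x \<in> grid N d" using x VX XS S by blast
        have "(\<Sum>p\<in>C x. ln (real p)) \<le> ln (real_of_int \<bar>f x\<bar>)"
        proof (rule sum_ln_primes_le[OF _ _ nz])
          show "finite (C x)" using P by (simp add: C_def)
          fix p assume "p \<in> C x"
          then obtain t z where t: "p \<in> P" "t \<in> Z" "z \<in> S' t" "res p x = res p z" by (auto simp: C_def)
          have "int p dvd f x - f z" using f(1) t(4) unfolding cong_preserving_def by blast
          then show "prime p \<and> int p dvd f x" using P(2)[OF t(1)] f0[OF t(2,3)] by simp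
        qed
        also have "\<dots> \<le> ln (real N ^ D)"
        proof (rule ln_mono)
          have "\<bar>f x\<bar> \<le> int N ^ D" using f(2) xg by blast
          then have "real_of_int \<bar>f x\<bar> \<le> real_of_int (int N ^ D)" by (rule of_int_le_iff[THEN iffD2])
          then show "real_of_int \<bar>f x\<bar> \<le> real N ^ D" by simp
        qed (use nz N in auto)
        also have "\<dots> = real D * ln (real N)" using N by (simp add: ln_realpow)
        finally show False using x by (simp add: V_def)
      qed
    qed
    show "\<forall>p\<in>P. \<forall>y. real (card {z\<in>V. z \<in> H p \<and> res p z = res p y}) \<le> \<beta>0 * b / \<delta> * real (card V) / real p ^ Suc k"
    proof (intro ballI allI)
      fix p y assume p: "p \<in> P"
      have pp: "real p > 0" using prime_gt_0_nat[OF P(2)[OF p]] by simp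
      let ?U = "{t\<in>T. p \<in> Pt t \<and> t mod int p = y i mod int p}"
      have finU: "finite ?U" using finT by simp
      \<comment> \<open>A class modulo p meets only sections with t congruent to \<open>y i\<close>.
        These hold at most \<open>b * card S / p\<close> points together, of which each section puts
        at most a fraction \<open>\<beta>0 / p ^ k\<close> into the class; this yields the exponent
        \<open>Suc k\<close>.\<close>
      have "{z\<in>V. z \<in> H p \<and> res p z = res p y} \<subseteq> (\<Union>t\<in>?U. {z\<in>S' t. z \<in> G t p \<and> res p z = res p y})"
      proof
        fix z assume z: "z \<in> {z\<in>V. z \<in> H p \<and> res p z = res p y}"
        then have "z \<in> X" "z \<in> G (z i) p" "p \<in> Pt (z i)" and r: "res p z = res p y" using VX by (auto simp: H_def)
        moreover have "z i mod int p = y i mod int p" using r unfolding res_def by metis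
        ultimately show "z \<in> (\<Union>t\<in>?U. {z\<in>S' t. z \<in> G t p \<and> res p z = res p y})" using Xt[of z] by auto
      qed
      then have "card {z\<in>V. z \<in> H p \<and> res p z = res p y} \<le> card (\<Union>t\<in>?U. {z\<in>S' t. z \<in> G t p \<and> res p z = res p y})"
        using finU finS' by (intro card_mono) auto
      also have "\<dots> \<le> (\<Sum>t\<in>?U. card {z\<in>S' t. z \<in> G t p \<and> res p z = res p y})" by (rule card_UN_le[OF finU])
      finally have "card {z\<in>V. z \<in> H p \<and> res p z = res p y} \<le> (\<Sum>t\<in>?U. card {z\<in>S' t. z \<in> G t p \<and> res p z = res p y})" .
      then have "real (card {z\<in>V. z \<in> H p \<and> res p z = res p y}) \<le> real (\<Sum>t\<in>?U. card {z\<in>S' t. z \<in> G t p \<and> res p z = res p y})"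
        by (rule of_nat_mono)
      also have "\<dots> = (\<Sum>t\<in>?U. real (card {z\<in>S' t. z \<in> G t p \<and> res p z = res p y}))" by simp
      also have "\<dots> \<le> (\<Sum>t\<in>?U. \<beta>0 / real p ^ k * real (card {x\<in>S. x i = t}))"
      proof (rule sum_mono)
        fix t assume t: "t \<in> ?U"
        have "card (S' t) \<le> card {x\<in>S. x i = t}" using t fin sub by (intro card_mono) auto
        then have "\<beta>0 / real p ^ k * real (card (S' t)) \<le> \<beta>0 / real p ^ k * real (card {x\<in>S. x i = t})"
          using pos by (intro mult_left_mono) auto
        moreover have "real (card {z\<in>S' t. z \<in> G t p \<and> res p z = res p y}) \<le> \<beta>0 * real (card (S' t)) / real p ^ k"
          using few t by blast
        ultimately show "real (card {z\<in>S' t. z \<in> G t p \<and> res p z = res p y}) \<le> \<beta>0 / real p ^ k * real (card {x\<in>S. x i = t})"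
          by simp
      qed
      also have "\<dots> = \<beta>0 / real p ^ k * real (\<Sum>t\<in>?U. card {x\<in>S. x i = t})" by (simp add: sum_distrib_left)
      also have "(\<Sum>t\<in>?U. card {x\<in>S. x i = t}) = card (\<Union>t\<in>?U. {x\<in>S. x i = t})"
        using finU fin by (subst card_UN_disjoint) auto
      also have "\<beta>0 / real p ^ k * real \<dots> \<le> \<beta>0 / real p ^ k * (b * real (card S) / real p)"
      proof (rule mult_left_mono)
        show "real (card (\<Union>t\<in>?U. {x\<in>S. x i = t})) \<le> b * real (card S) / real p"
        proof (cases "?U = {}")
          case True
          show ?thesis unfolding True using b by simp
        next
          case False
          then obtain t where t: "t \<in> T" "p \<in> Pt t" "t mod int p = y i mod int p" by auto
          have "card (\<Union>t\<in>?U. {x\<in>S. x i = t}) \<le> card {x\<in>S. x i mod int p = t mod int p}"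
            using fin t by (intro card_mono) auto
          then show ?thesis using nonheavy[OF t(1,2)] by linarith
        qed
        show "0 \<le> \<beta>0 / real p ^ k" using pos by simp
      qed
      also have "\<dots> = \<beta>0 * b / real p ^ Suc k * real (card S)" by (simp add: mult_ac)
      also have "\<dots> \<le> \<beta>0 * b / real p ^ Suc k * (real (card V) / \<delta>)"
        using cVS \<delta> pos b by (intro mult_left_mono) (auto simp: pos_le_divide_eq mult.commute)
      finally show "real (card {z\<in>V. z \<in> H p \<and> res p z = res p y}) \<le> \<beta>0 * b / \<delta> * real (card V) / real p ^ Suc k"
        by (simp add: mult_ac)
    qed
    show "\<forall>x\<in>V. c1 / 2 * wP P \<le> wP {p\<in>P. x \<in> H p}"
    proof
      fix x assume "x \<in> V"
      then have x: "x i \<in> T" "x \<in> S' (x i)" using VX Xt by auto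
      have "{p\<in>Pt (x i). x \<in> G (x i) p} = {p\<in>P. x \<in> H p}" using Pt[OF x(1)] by (auto simp: H_def)
      then show "c1 / 2 * wP P \<le> wP {p\<in>P. x \<in> H p}" using wt[OF x] by simp
    qed
  qed
qed

section \<open>Choice of the parameters for large N\<close>

lemma eventually_ln_ge: "\<forall>\<^sub>F N in sequentially. C \<le> ln (real N)"
  using filterlim_compose[OF ln_at_top filterlim_real_sequentially] by (simp add: filterlim_at_top)

lemma eventually_powr_ge:
  fixes a :: real
  assumes "a > 0"
  shows "\<forall>\<^sub>F N in sequentially. C \<le> real N powr a"
  using eventually_ln_ge[of "ln (max C 1) / a"] eventually_ge_at_top[of 1]
proof eventually_elim
  case (elim N)
  have "C \<le> exp (ln (max C 1))" by simp
  also have "\<dots> \<le> exp (a * ln (real N))"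
    unfolding exp_le_cancel_iff using elim(1) assms by (simp add: pos_divide_le_eq mult.commute)
  also have "\<dots> = real N powr a" using elim by (simp add: powr_def)
  finally show ?case .
qed

text \<open>The order of quantifiers matters: the proportion and \<open>K\<close> are fixed before
  \<open>D\<close>, so that \<open>D\<close> can later be chosen in terms of \<open>K\<close>, and
  the threshold for N may depend on \<open>D\<close>. The constants \<open>\<alpha>\<close>,
  \<open>\<kappa>\<close> and \<open>c0\<close> must vary in the induction, because sections satisfy
  the hypotheses only with \<open>L\<close>, \<open>\<kappa> / 2\<close> and
  \<open>c0 / (8 * d)\<close>.\<close>

lemma eventually_capturable:
  fixes d k :: nat and \<epsilon> \<alpha> \<kappa> c0 :: real
  assumes d: "d > 0" and \<epsilon>: "\<epsilon> > 0" and "\<alpha> > 0" "\<kappa> > 0" "c0 > 0"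
  shows "\<exists>\<delta>>0. \<exists>\<beta>>0. \<exists>c>0. \<exists>K. \<forall>D>0. \<forall>\<^sub>F N in sequentially. \<forall>P S.
    (\<forall>p\<in>P. prime p \<and> real p \<le> real N powr (\<epsilon> / (2 * real d))) \<longrightarrow> \<kappa> * ln (real N) \<le> wP P \<longrightarrow>
    S \<subseteq> grid N d \<longrightarrow> c0 * real N powr (real k - 1 + \<epsilon>) \<le> real (card S) \<longrightarrow>
    (\<forall>p\<in>P. real (card (res p ` S)) \<le> \<alpha> * real p ^ k) \<longrightarrow> capturable N d k D P \<delta> \<beta> c K S"
  using assms(3-5)
proof (induction k arbitrary: \<alpha> \<kappa> c0)
  case (0 \<alpha> \<kappa> c0)
  define Y where "Y = nat \<lceil>4 * \<alpha> / \<kappa>\<rceil> + 1"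
  have Y: "Y > 0" "4 * \<alpha> / \<kappa> \<le> real Y" unfolding Y_def by linarith+
  have "\<forall>\<^sub>F N in sequentially. \<forall>P S.
    (\<forall>p\<in>P. prime p \<and> real p \<le> real N powr (\<epsilon> / (2 * real d))) \<longrightarrow> \<kappa> * ln (real N) \<le> wP P \<longrightarrow>
    S \<subseteq> grid N d \<longrightarrow> c0 * real N powr (real 0 - 1 + \<epsilon>) \<le> real (card S) \<longrightarrow>
    (\<forall>p\<in>P. real (card (res p ` S)) \<le> \<alpha> * real p ^ 0) \<longrightarrow> capturable N d 0 D P (1 / (2 * \<alpha>)) 1 1 1 S" for D
    using eventually_ge_at_top[of 2] eventually_ln_ge[of "2 * real Y / \<kappa>"]
  proof eventually_elim
    case (elim N)
    show ?case
    proof (intro allI impI)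
      fix P :: "nat set" and S
      assume P: "\<forall>p\<in>P. prime p \<and> real p \<le> real N powr (\<epsilon> / (2 * real d))" and W: "\<kappa> * ln (real N) \<le> wP P"
        and S: "S \<subseteq> grid N d" and size: "c0 * real N powr (real 0 - 1 + \<epsilon>) \<le> real (card S)"
        and cl: "\<forall>p\<in>P. real (card (res p ` S)) \<le> \<alpha> * real p ^ 0"
      have "real N powr (\<epsilon> / (2 * real d)) \<ge> 1" using elim(1) d \<epsilon> by (intro ge_one_powr_ge_zero) auto
      then have finP: "finite P" using sum_ln_primes_bound(1) P by blast
      have "0 < c0 * real N powr (real 0 - 1 + \<epsilon>)" using 0 elim(1) by simp
      then have "0 < real (card S)" using size by linarith
      then have "S \<noteq> {}" by auto
      moreover have "2 * real Y \<le> \<kappa> * ln (real N)" using elim(2) 0 by (simp add: pos_divide_le_eq mult.commute)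
      ultimately show "capturable N d 0 D P (1 / (2 * \<alpha>)) 1 1 1 S"
        using P cl Y W elim(1) 0 by (intro capturable_0[OF S _ _ _ _ _ finP, of \<alpha> \<kappa> Y]) auto
    qed
  qed
  then show ?case using 0 by (intro exI[of _ "1 / (2 * \<alpha>)"] exI[of _ 1] conjI) auto
next
  case (Suc k \<alpha> \<kappa> c0)
  note pos = Suc.prems
  define b where "b = 8 / \<kappa>"
  define L where "L = 32 * real d * \<alpha> * b"
  have bL: "b > 0" "L > 0" using pos d by (auto simp: b_def L_def)
  obtain \<delta>0 \<beta>0 c1 :: real and K0 :: nat where c: "\<delta>0 > 0" "\<beta>0 > 0" "c1 > 0" and
    IH: "\<And>D. D > 0 \<Longrightarrow> \<forall>\<^sub>F N in sequentially. \<forall>P S.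
    (\<forall>p\<in>P. prime p \<and> real p \<le> real N powr (\<epsilon> / (2 * real d))) \<longrightarrow> \<kappa> / 2 * ln (real N) \<le> wP P \<longrightarrow>
    S \<subseteq> grid N d \<longrightarrow> c0 / (8 * real d) * real N powr (real k - 1 + \<epsilon>) \<le> real (card S) \<longrightarrow>
    (\<forall>p\<in>P. real (card (res p ` S)) \<le> L * real p ^ k) \<longrightarrow> capturable N d k D P \<delta>0 \<beta>0 c1 K0 S"
    using Suc.IH[of L "\<kappa> / 2" "c0 / (8 * real d)"] pos bL d by auto
  define \<delta>1 where "\<delta>1 = \<delta>0 / (8 * real d)"
  define \<mu> where "\<mu> = (c1 / 4)\<^sup>2 / (\<alpha> * \<beta>0) * \<kappa>"
  define \<delta> where "\<delta> = \<mu> / 4 * \<delta>1"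
  define K1 where "K1 = nat \<lceil>8 / \<mu>\<rceil> + 1"
  define \<theta> where "\<theta> = \<epsilon> / (2 * real d)"
  \<comment> \<open>Strictly between \<open>\<theta>\<close> and \<open>\<epsilon> / d\<close>. The
    gap above \<open>\<theta>\<close> absorbs the constant \<open>M\<close> in the trivial bound for
    \<open>\<Sum>ln p\<close>; the gap below \<open>\<epsilon> / d\<close> makes a box of side
    \<open>N powr \<theta>'\<close> small compared with \<open>S\<close>.\<close>
  define \<theta>' where "\<theta>' = 3 * \<epsilon> / (4 * real d)"
  have \<mu>: "\<mu> > 0" and \<delta>1: "\<delta>1 > 0" using pos c d by (auto simp: \<mu>_def \<delta>1_def)
  have \<delta>: "\<delta> > 0" using \<mu> \<delta>1 by (simp add: \<delta>_def)
  have K1: "8 / \<mu> \<le> real K1" "K1 > 0" unfolding K1_def by linarith+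
  define M where "M = min 1 (\<mu> / 8 * \<delta>1)"
  have M: "M > 0" using \<mu> \<delta>1 by (simp add: M_def)
  have "\<forall>\<^sub>F N in sequentially. \<forall>P S.
    (\<forall>p\<in>P. prime p \<and> real p \<le> real N powr (\<epsilon> / (2 * real d))) \<longrightarrow> \<kappa> * ln (real N) \<le> wP P \<longrightarrow>
    S \<subseteq> grid N d \<longrightarrow> c0 * real N powr (real (Suc k) - 1 + \<epsilon>) \<le> real (card S) \<longrightarrow>
    (\<forall>p\<in>P. real (card (res p ` S)) \<le> \<alpha> * real p ^ Suc k) \<longrightarrow>
    capturable N d (Suc k) D P \<delta> (\<beta>0 * b / \<delta>) (c1 / 2) (K0 * K1) S" if D: "D > 0" for D
  proof -
    define r where "r = (c1 / 4)\<^sup>2 / (\<alpha> * \<beta>0) / (2 * real (K1 * D))"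
    have r: "r > 0" using c pos K1(2) D by (simp add: r_def)
    \<comment> \<open>Large enough for the overlap hypothesis of \<open>section_cover\<close>. It
      depends on \<open>D\<close> through r, hence so does the threshold for N.\<close>
    define Y where "Y = nat \<lceil>b\<^sup>2 / (\<delta>1\<^sup>2 * r)\<rceil> + 1"
    have Y0: "Y > 0" and Y: "b\<^sup>2 / (\<delta>1\<^sup>2 * r) \<le> real Y" unfolding Y_def by linarith+
    then have Yr: "b\<^sup>2 / (\<delta>1\<^sup>2 * real Y) \<le> r" using r \<delta>1 by (simp add: field_simps)
    have e4: "\<epsilon> / 4 > 0" "\<theta>' - \<theta> > 0" using \<epsilon> d by (auto simp: \<theta>_def \<theta>'_def field_simps)
    show ?thesis
      using IH[OF D] eventually_ge_at_top[of 2] eventually_ln_ge[of "real Y / (c1 / 4 * \<kappa>)"]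
        eventually_powr_ge[OF e4(1), of "2 / c0"] eventually_powr_ge[OF e4(2), of "\<theta> / M"]
    proof eventually_elim
      case (elim N)
      note N = elim(2)
      show ?case
      proof (intro allI impI)
        fix P :: "nat set" and S
        assume P: "\<forall>p\<in>P. prime p \<and> real p \<le> real N powr (\<epsilon> / (2 * real d))" and W: "\<kappa> * ln (real N) \<le> wP P"
          and S: "S \<subseteq> grid N d" and size: "c0 * real N powr (real (Suc k) - 1 + \<epsilon>) \<le> real (card S)"
          and cl: "\<forall>p\<in>P. real (card (res p ` S)) \<le> \<alpha> * real p ^ Suc k"
        have size': "c0 * real N powr (real k + \<epsilon>) \<le> real (card S)" using size by simp
        have "0 < c0 * real N powr (real k + \<epsilon>)" using pos N by simp
        then have "0 < real (card S)" using size' by linarith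
        then have Sne: "S \<noteq> {}" by auto
        have lnN: "ln (real N) > 0" using N by simp
        have N\<theta>: "real N powr \<theta> \<ge> 1" using N d \<epsilon> by (intro ge_one_powr_ge_zero) (auto simp: \<theta>_def)
        have P\<theta>: "\<And>p. p \<in> P \<Longrightarrow> prime p \<and> real p \<le> real N powr \<theta>" using P by (simp add: \<theta>_def)
        note finP = sum_ln_primes_bound(1)[OF P\<theta> N\<theta>]
        have lnP: "(\<Sum>p\<in>P. ln (real p)) \<le> M * (real N powr \<theta>' * ln (real N))"
        proof -
          have "(\<Sum>p\<in>P. ln (real p)) \<le> real N powr \<theta> * ln (real N powr \<theta>)"
            by (rule sum_ln_primes_bound(2)[OF P\<theta> N\<theta>])
          also have "\<dots> = \<theta> * (real N powr \<theta> * ln (real N))" using N by (simp add: ln_powr)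
          also have "\<dots> \<le> (M * real N powr (\<theta>' - \<theta>)) * (real N powr \<theta> * ln (real N))"
            using elim(5) M lnN by (intro mult_right_mono) (auto simp: pos_divide_le_eq mult.commute)
          also have "\<dots> = M * ((real N powr (\<theta>' - \<theta>) * real N powr \<theta>) * ln (real N))" by (simp only: mult_ac)
          also have "real N powr (\<theta>' - \<theta>) * real N powr \<theta> = real N powr \<theta>'"
            by (subst powr_add[symmetric]) simp
          finally show ?thesis .
        qed
        have big: "(real N powr \<theta>') ^ d \<le> real (card S) / 2"
        proof -
          have "(real N powr \<theta>') ^ d = real N powr (\<theta>' * real d)"
            using N by (simp add: powr_powr[symmetric] powr_realpow)
          also have "\<theta>' * real d = 3 * \<epsilon> / 4" using d by (simp add: \<theta>'_def)
          also have "real N powr (3 * \<epsilon> / 4) = 1 * real N powr (3 * \<epsilon> / 4)" by simp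
          also have "\<dots> \<le> (c0 / 2 * real N powr (\<epsilon> / 4)) * real N powr (3 * \<epsilon> / 4)"
            using elim(4) pos by (intro mult_right_mono) (auto simp: pos_divide_le_eq mult.commute)
          also have "\<dots> = c0 / 2 * (real N powr (\<epsilon> / 4) * real N powr (3 * \<epsilon> / 4))" by simp
          also have "real N powr (\<epsilon> / 4) * real N powr (3 * \<epsilon> / 4) = real N powr \<epsilon>"
            by (subst powr_add[symmetric]) simp
          also have "c0 / 2 * real N powr \<epsilon> \<le> c0 / 2 * real N powr (real k + \<epsilon>)"
            using pos N by (intro mult_left_mono powr_mono) auto
          finally show ?thesis using size' by simp
        qed
        have Yln: "real Y \<le> c1 / 4 * (\<kappa> * ln (real N))"
        proof -
          have "c1 / 4 * \<kappa> > 0" using c pos by simp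
          then show ?thesis using elim(3) by (simp add: pos_divide_le_eq mult_ac)
        qed
        show "capturable N d (Suc k) D P \<delta> (\<beta>0 * b / \<delta>) (c1 / 2) (K0 * K1) S"
        proof (rule capturable_Suc[OF S Sne d N D pos c Y0 finP _ W size' big, folded b_def, folded L_def \<delta>1_def \<mu>_def, folded \<delta>_def])
          show "(\<Sum>p\<in>P. ln (real p)) \<le> min 1 (\<mu> / 8 * \<delta>1) * (real N powr \<theta>' * ln (real N))"
            using lnP by (simp add: M_def)
          show "b\<^sup>2 / (\<delta>1\<^sup>2 * real Y) \<le> (c1 / 4)\<^sup>2 / (\<alpha> * \<beta>0) / (2 * real (K1 * D))"
            using Yr by (simp add: r_def)
          show "capturable N d k D P0 \<delta>0 \<beta>0 c1 K0 S0" if "P0 \<subseteq> P" "\<kappa> / 2 * ln (real N) \<le> wP P0"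
            "S0 \<subseteq> grid N d" "c0 / (8 * real d) * real N powr (real k - 1 + \<epsilon>) \<le> real (card S0)"
            "\<forall>p\<in>P0. real (card (res p ` S0)) \<le> L * real p ^ k" for S0 P0
            using elim(1) P that by blast
        qed (use P cl K1 Yln in auto)
      qed
    qed
  qed
  then show ?case using \<delta> c bL by (intro exI[of _ \<delta>] exI[of _ "\<beta>0 * b / \<delta>"] exI[of _ "c1 / 2"] exI[of _ "K0 * K1"] conjI) auto
qed

section \<open>Siegel's lemma\<close>

lemma finite_exps: "finite (exps d D)"
proof -
  have "exps d D \<subseteq> {e. (\<forall>i<d. e i \<in> {..nat \<lfloor>D\<rfloor>}) \<and> (\<forall>i\<ge>d. e i = 0)}"
  proof
    fix e assume e: "e \<in> exps d D"
    have "e i \<le> nat \<lfloor>D\<rfloor>" if "i < d" for i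
    proof -
      have "e i \<le> (\<Sum>i<d. e i)" using that by (intro member_le_sum) auto
      moreover have "real (\<Sum>i<d. e i) \<le> D" using e by (simp add: exps_def)
      ultimately show ?thesis by (intro le_nat_floor) linarith
    qed
    then show "e \<in> {e. (\<forall>i<d. e i \<in> {..nat \<lfloor>D\<rfloor>}) \<and> (\<forall>i\<ge>d. e i = 0)}"
      using e by (simp add: exps_def)
  qed
  then show ?thesis
    using finite_card_box(1)[of d "\<lambda>_. {..nat \<lfloor>D\<rfloor>}" 0] finite_subset by auto
qed

lemma cong_preserving_poly_eval: "cong_preserving (poly_eval d D a)"
  unfolding cong_preserving_def
proof (intro allI impI)
  fix p x y assume "res p x = res p y"
  then have xy: "x i mod int p = y i mod int p" for i unfolding res_def by metis
  have "(\<Prod>i<d. x i ^ e i) mod int p = (\<Prod>i<d. y i ^ e i) mod int p" for e :: "nat \<Rightarrow> nat"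
  proof -
    have "x i ^ e i mod int p = y i ^ e i mod int p" for i
      using arg_cong[OF xy[of i], of "\<lambda>z. z ^ e i mod int p"] by (simp only: power_mod)
    then have "(\<Prod>i<d. x i ^ e i mod int p) mod int p = (\<Prod>i<d. y i ^ e i mod int p) mod int p" by simp
    then show ?thesis by (simp only: mod_prod_eq)
  qed
  from arg_cong[OF this, of "\<lambda>z. a e * z mod int p" for e]
  have "a e * (\<Prod>i<d. x i ^ e i) mod int p = a e * (\<Prod>i<d. y i ^ e i) mod int p" for e
    by (simp only: mod_mult_right_eq)
  then have "(\<Sum>e\<in>exps d D. a e * (\<Prod>i<d. x i ^ e i) mod int p) mod int p
    = (\<Sum>e\<in>exps d D. a e * (\<Prod>i<d. y i ^ e i) mod int p) mod int p" by simp
  then have "poly_eval d D a x mod int p = poly_eval d D a y mod int p"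
    unfolding poly_eval_def by (simp only: mod_sum_eq)
  then show "int p dvd poly_eval d D a x - poly_eval d D a y" by (simp add: mod_eq_dvd_iff)
qed

text \<open>Pigeonhole over polynomials with exponents below n and coefficients in
  \<open>{0..H}\<close>. Coordinates of grid points are nonnegative, so values lie in
  \<open>{0..H^2}\<close>, where \<open>H\<close> is chosen to make
  \<open>n ^ d * H * N ^ (d * n)\<close> equal to \<open>H^2\<close>. Since
  \<open>2 * card A \<le> n ^ d\<close>, there are fewer value vectors on \<open>A\<close> than
  polynomials, and the difference of two with equal values vanishes on \<open>A\<close>.\<close>

lemma siegel:
  fixes A :: "(nat \<Rightarrow> int) set" and C :: real and n N d :: nat
  defines "H \<equiv> n ^ d * N ^ (d * n)"
  assumes A: "A \<subseteq> grid N d" and n: "n > 0" and N: "N > 0" and cA: "2 * card A \<le> n ^ d" and C: "real (d * n) \<le> C"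
  obtains a where "\<exists>e\<in>exps d C. a e \<noteq> 0" "\<And>e. \<bar>a e\<bar> \<le> int H"
    "\<And>x. x \<in> A \<Longrightarrow> poly_eval d C a x = 0" "\<And>x. x \<in> grid N d \<Longrightarrow> \<bar>poly_eval d C a x\<bar> \<le> int (H\<^sup>2)"
proof -
  define E where "E = {e :: nat \<Rightarrow> nat. (\<forall>i<d. e i \<in> {..<n}) \<and> (\<forall>i\<ge>d. e i = 0)}"
  have finE: "finite E" and cE: "card E = n ^ d"
    using finite_card_box[of d "\<lambda>_. {..<n}" 0] by (auto simp: E_def)
  have EC: "E \<subseteq> exps d C"
  proof
    fix e assume e: "e \<in> E"
    have "(\<Sum>i<d. e i) \<le> (\<Sum>i<d. n)" using e by (intro sum_mono) (auto simp: E_def less_imp_le)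
    then have "real (\<Sum>i<d. e i) \<le> real (d * n)" by (simp only: of_nat_le_iff) simp
    then show "e \<in> exps d C" using e C by (simp add: exps_def E_def del: of_nat_sum)
  qed
  have finA: "finite A" using A finite_grid finite_subset by blast
  have H: "H > 0" using n N by (simp add: H_def)
  define mon where "mon e x = (\<Prod>i<d. x i ^ e i)" for e :: "nat \<Rightarrow> nat" and x :: "nat \<Rightarrow> int"
  have mon: "0 \<le> mon e x \<and> mon e x \<le> int (N ^ (d * n))" if "e \<in> E" "x \<in> grid N d" for e x
  proof -
    have "x i ^ e i \<ge> 0 \<and> x i ^ e i \<le> int N ^ n" if i: "i < d" for i
    proof -
      have x: "0 \<le> x i" "x i \<le> int N" using i \<open>x \<in> grid N d\<close> by (auto simp: grid_def)
      then have "x i ^ e i \<le> int N ^ e i" by (intro power_mono) auto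
      also have "\<dots> \<le> int N ^ n" using N i \<open>e \<in> E\<close> by (intro power_increasing) (auto simp: E_def less_imp_le)
      finally show ?thesis using x by simp
    qed
    then have "0 \<le> mon e x" "mon e x \<le> (\<Prod>i<d. int N ^ n)"
      unfolding mon_def by (blast intro!: prod_nonneg prod_mono)+
    then show ?thesis by (simp add: power_mult[symmetric] mult.commute)
  qed
  define ev where "ev a x = (\<Sum>e\<in>E. a e * mon e x)" for a x
  define \<Phi> where "\<Phi> a = restrict (ev a) A" for a
  have sumH: "(\<Sum>e\<in>E. int H * int (N ^ (d * n))) = int (H\<^sup>2)"
    by (simp add: cE H_def power2_eq_square)
  let ?F = "E \<rightarrow>\<^sub>E {0..int H}" and ?G = "A \<rightarrow>\<^sub>E {0..int (H\<^sup>2)}"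
  have "\<Phi> ` ?F \<subseteq> ?G"
  proof
    fix g assume "g \<in> \<Phi> ` ?F"
    then obtain a where a: "a \<in> ?F" "g = \<Phi> a" by auto
    have "0 \<le> ev a x \<and> ev a x \<le> int (H\<^sup>2)" if x: "x \<in> A" for x
    proof
      have ae: "0 \<le> a e" "a e \<le> int H" if "e \<in> E" for e using PiE_mem[OF a(1) that] by auto
      show "0 \<le> ev a x" unfolding ev_def using ae mon x A by (intro sum_nonneg mult_nonneg_nonneg) auto
      have "ev a x \<le> (\<Sum>e\<in>E. int H * int (N ^ (d * n)))"
        unfolding ev_def using ae mon x A by (intro sum_mono mult_mono) auto
      then show "ev a x \<le> int (H\<^sup>2)" by (simp only: sumH)
    qed
    then show "g \<in> ?G" by (auto simp: a(2) \<Phi>_def)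
  qed
  then have "card (\<Phi> ` ?F) \<le> card ?G" using finA by (intro card_mono finite_PiE) auto
  also have "\<dots> = (H\<^sup>2 + 1) ^ card A" using finA by (simp add: card_funcsetE nat_add_distrib nat_power_eq)
  also have "\<dots> < (H + 1) ^ n ^ d"
  proof (cases "card A = 0")
    case True
    have "1 < (H + 1) ^ n ^ d" using H n by (intro one_less_power) auto
    then show ?thesis using True by simp
  next
    case False
    have "(H\<^sup>2 + 1) ^ card A < ((H + 1)\<^sup>2) ^ card A"
      using False H by (intro power_strict_mono) (auto simp: power2_eq_square)
    also have "\<dots> = (H + 1) ^ (2 * card A)" by (rule power_mult[symmetric])
    also have "\<dots> \<le> (H + 1) ^ n ^ d" using cA by (intro power_increasing) auto
    finally show ?thesis .
  qed
  also have "\<dots> = card ?F" using finE by (simp add: card_funcsetE cE nat_add_distrib)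
  finally have "\<not> inj_on \<Phi> ?F" by (rule pigeonhole)
  then obtain u v where uv: "u \<in> ?F" "v \<in> ?F" "u \<noteq> v" "\<Phi> u = \<Phi> v" by (auto simp: inj_on_def)
  \<comment> \<open>Coefficients outside the box are 0, so that the sum over the larger set
    \<open>exps d C\<close> reduces to the sum over \<open>E\<close>.\<close>
  define a where "a e = (if e \<in> E then u e - v e else 0)" for e
  have aH: "\<bar>a e\<bar> \<le> int H" for e
    using PiE_mem[OF uv(1), of e] PiE_mem[OF uv(2), of e] by (auto simp: a_def)
  have pe: "poly_eval d C a x = (\<Sum>e\<in>E. a e * mon e x)" for x
    unfolding poly_eval_def mon_def
    using EC finite_exps by (intro sum.mono_neutral_right) (auto simp: a_def)
  show thesis
  proof (rule that[of a])
    obtain e where e: "u e \<noteq> v e" using uv(3) by auto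
    then have "e \<in> E" using PiE_arb[OF uv(1), of e] PiE_arb[OF uv(2), of e] by metis
    then show "\<exists>e\<in>exps d C. a e \<noteq> 0" using e EC by (intro bexI[of _ e]) (auto simp: a_def)
    show "\<bar>a e\<bar> \<le> int H" for e by (rule aH)
    show "poly_eval d C a x = 0" if x: "x \<in> A" for x
    proof -
      have "ev u x = ev v x" using fun_cong[OF uv(4), of x] x by (simp add: \<Phi>_def)
      then have "(\<Sum>e\<in>E. (u e - v e) * mon e x) = 0"
        by (simp add: ev_def left_diff_distrib sum_subtractf)
      then show ?thesis by (simp add: pe a_def)
    qed
    show "\<bar>poly_eval d C a x\<bar> \<le> int (H\<^sup>2)" if x: "x \<in> grid N d" for x
    proof -
      have "\<bar>poly_eval d C a x\<bar> \<le> (\<Sum>e\<in>E. \<bar>a e * mon e x\<bar>)" unfolding pe by (rule sum_abs)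
      also have "\<dots> \<le> (\<Sum>e\<in>E. int H * int (N ^ (d * n)))"
      proof (rule sum_mono)
        fix e assume "e \<in> E"
        then have "\<bar>mon e x\<bar> \<le> int (N ^ (d * n))" using mon x by fastforce
        then show "\<bar>a e * mon e x\<bar> \<le> int H * int (N ^ (d * n))"
          unfolding abs_mult using aH by (intro mult_mono) auto
      qed
      finally show ?thesis by (simp only: sumH)
    qed
  qed
qed

text \<open>While at least a proportion \<open>\<eta>\<close> of \<open>S\<close> is left, the rest
  is capturable; each round adds at most \<open>K * D ^ k\<close> points to \<open>A\<close> and
  shrinks the rest by the factor \<open>1 - \<delta>\<close>. Once the rest is smaller, nothing more
  is done. Capping \<open>\<delta>\<close> at 1 keeps this factor nonnegative.\<close>

lemma iterate_capturable:
  fixes \<eta> \<delta>0 :: real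
  defines "\<delta> \<equiv> min \<delta>0 1"
  assumes fin: "finite S" and \<delta>0: "\<delta>0 > 0"
    and cap: "\<And>S0. S0 \<subseteq> S \<Longrightarrow> \<eta> * real (card S) \<le> real (card S0) \<Longrightarrow> capturable N d k D P \<delta>0 \<beta> c K S0"
  shows "\<exists>U\<subseteq>S. \<exists>A\<subseteq>S. card A \<le> n * (K * D ^ k) \<and>
    real (card (S - U)) \<le> max \<eta> ((1 - \<delta>) ^ n) * real (card S) \<and>
    (\<forall>f. cong_preserving f \<longrightarrow> (\<forall>x\<in>grid N d. \<bar>f x\<bar> \<le> int N ^ D) \<longrightarrow> (\<forall>x\<in>A. f x = 0)
        \<longrightarrow> (\<forall>x\<in>U. f x = 0))"
proof (induction n)
  case 0
  have "1 * real (card S) \<le> max \<eta> 1 * real (card S)" by (rule mult_right_mono) auto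
  then show ?case by (intro exI[of _ "{}"]) auto
next
  case (Suc n)
  then obtain U A where U: "U \<subseteq> S" and A: "A \<subseteq> S" "card A \<le> n * (K * D ^ k)"
    and c: "real (card (S - U)) \<le> max \<eta> ((1 - \<delta>) ^ n) * real (card S)"
    and v: "\<And>f. cong_preserving f \<Longrightarrow> (\<forall>x\<in>grid N d. \<bar>f x\<bar> \<le> int N ^ D) \<Longrightarrow> (\<forall>x\<in>A. f x = 0)
        \<Longrightarrow> (\<forall>x\<in>U. f x = 0)" by blast
  show ?case
  proof (cases "\<eta> * real (card S) \<le> real (card (S - U))")
    case False
    have "real (card (S - U)) \<le> max \<eta> ((1 - \<delta>) ^ Suc n) * real (card S)"
      using False by (intro order.trans[OF _ mult_right_mono[OF max.cobounded1]]) auto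
    moreover have "card A \<le> Suc n * (K * D ^ k)" using A(2) by simp
    ultimately show ?thesis using U A v by blast
  next
    case True
    then have "capturable N d k D P \<delta>0 \<beta> c K (S - U)" by (intro cap) auto
    then obtain U' A' where U': "U' \<subseteq> S - U" and A': "A' \<subseteq> S - U" "card A' \<le> K * D ^ k"
      and c': "\<delta>0 * real (card (S - U)) \<le> real (card U')"
      and v': "\<And>f. cong_preserving f \<Longrightarrow> (\<forall>x\<in>grid N d. \<bar>f x\<bar> \<le> int N ^ D) \<Longrightarrow> (\<forall>x\<in>A'. f x = 0)
        \<Longrightarrow> (\<forall>x\<in>U'. f x = 0)" unfolding capturable_def by blast
    have \<delta>: "0 < \<delta>" "\<delta> \<le> 1" using \<delta>0 by (auto simp: \<delta>_def)
    have "\<delta> * real (card (S - U)) \<le> \<delta>0 * real (card (S - U))" by (intro mult_right_mono) (auto simp: \<delta>_def)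
    then have c': "\<delta> * real (card (S - U)) \<le> real (card U')" using c' by linarith
    have "S - (U \<union> U') = (S - U) - U'" by auto
    then have "real (card (S - (U \<union> U'))) = real (card (S - U)) - real (card U')"
      using fin U' finite_subset[OF U'] by (simp add: card_Diff_subset card_mono of_nat_diff)
    also have "\<dots> \<le> (1 - \<delta>) * real (card (S - U))" using c' by (simp add: algebra_simps)
    also have "\<dots> \<le> (1 - \<delta>) * (max \<eta> ((1 - \<delta>) ^ n) * real (card S))" using c \<delta> by (intro mult_left_mono) auto
    also have "\<dots> = ((1 - \<delta>) * max \<eta> ((1 - \<delta>) ^ n)) * real (card S)" by simp
    also have "\<dots> \<le> max \<eta> ((1 - \<delta>) ^ Suc n) * real (card S)"
    proof (rule mult_right_mono)
      show "(1 - \<delta>) * max \<eta> ((1 - \<delta>) ^ n) \<le> max \<eta> ((1 - \<delta>) ^ Suc n)"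
      proof (cases "\<eta> \<le> (1 - \<delta>) ^ n")
        case True
        then show ?thesis by (simp add: max_def)
      next
        case False
        have "0 \<le> (1 - \<delta>) ^ n" using \<delta> by simp
        then have "0 \<le> \<eta>" using False by linarith
        then have "(1 - \<delta>) * \<eta> \<le> 1 * \<eta>" using \<delta> by (intro mult_right_mono) auto
        then show ?thesis using False by simp
      qed
    qed simp
    finally have "real (card (S - (U \<union> U'))) \<le> max \<eta> ((1 - \<delta>) ^ Suc n) * real (card S)" .
    moreover have "card (A \<union> A') \<le> Suc n * (K * D ^ k)"
      using card_Un_le[of A A'] A(2) A'(2) by simp
    moreover have "U \<union> U' \<subseteq> S" "A \<union> A' \<subseteq> S" using U U' A A' by auto
    ultimately show ?thesis using v v' by (intro exI[of _ "U \<union> U'"] conjI exI[of _ "A \<union> A'"]) blast+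
  qed
qed

text \<open>For \<open>N = 1\<close> the bound \<open>N powr C\<close> equals 1 and admits only
  coefficients -1, 0, 1. The polynomial with value \<open>x 0 ^ 2 - x 0\<close> satisfies it and
  vanishes on the whole grid.\<close>

lemma poly_eval_boolean:
  assumes d: "d > 0" and C: "2 \<le> C"
  defines "a \<equiv> \<lambda>e. if e = (\<lambda>_. 0)(0 := 2) then 1 else if e = (\<lambda>_. 0)(0 := 1) then -1 else (0::int)"
  shows "poly_eval d C a x = (x 0)\<^sup>2 - x 0" and "\<exists>e\<in>exps d C. a e \<noteq> 0"
proof -
  let ?e = "\<lambda>m::nat. (\<lambda>_. 0)(0 := m) :: nat \<Rightarrow> nat"
  have s: "(\<Sum>i<d. ?e m i) = m" for m
  proof -
    have "(\<Sum>i<d. ?e m i) = (\<Sum>i<d. if i = 0 then m else 0)" by (intro sum.cong) auto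
    then show ?thesis using d by simp
  qed
  have e: "?e 2 \<in> exps d C" "?e 1 \<in> exps d C" 
    using d C by (auto simp: exps_def s simp del: of_nat_sum)
  have ne: "?e 2 \<noteq> ?e 1" by (metis fun_upd_same numeral_eq_one_iff semiring_norm(85))
  have p: "(\<Prod>i<d. x i ^ ?e m i) = x 0 ^ m" for m
  proof -
    have "(\<Prod>i<d. x i ^ ?e m i) = (\<Prod>i<d. if i = 0 then x 0 ^ m else 1)" by (intro prod.cong) auto
    then show ?thesis using d by simp
  qed
  have "poly_eval d C a x = (\<Sum>e\<in>{?e 2, ?e 1}. a e * (\<Prod>i<d. x i ^ e i))"
    unfolding poly_eval_def using e finite_exps by (intro sum.mono_neutral_right) (auto simp: a_def)
  also have "\<dots> = a (?e 2) * (\<Prod>i<d. x i ^ ?e 2 i) + a (?e 1) * (\<Prod>i<d. x i ^ ?e 1 i)"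
    using ne by simp
  also have "\<dots> = (x 0)\<^sup>2 - x 0" unfolding p using ne by (simp add: a_def)
  finally show "poly_eval d C a x = (x 0)\<^sup>2 - x 0" .
  show "\<exists>e\<in>exps d C. a e \<noteq> 0" using e(1) by (intro bexI[of _ "?e 2"]) (auto simp: a_def)
qed

section \<open>Choice of the constants and the three ranges of N\<close>

theorem theorem2p4:
  fixes d k :: nat and \<epsilon> \<eta> \<kappa> \<alpha> c0 :: real
  assumes "k < d" and "\<epsilon> > 0" and "\<eta> > 0" and "\<kappa> > 0" and "\<alpha> > 0" and "c0 > 0"
  shows "\<exists>C::real. \<forall>(N::nat) (P::nat set) (S::(nat \<Rightarrow> int) set).
    N > 0 \<longrightarrow>
    P \<subseteq> {p. prime p \<and> real p \<le> real N powr (\<epsilon> / (2 * real d))} \<longrightarrow>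
    wP P \<ge> \<kappa> * ln (real N powr (\<epsilon> / (2 * real d))) \<longrightarrow>
    S \<subseteq> grid N d \<longrightarrow>
    real (card S) \<ge> c0 * real N powr (real k - 1 + \<epsilon>) \<longrightarrow>
    (\<forall>p\<in>P. real (card (residue_classes p S)) \<le> \<alpha> * real p ^ k) \<longrightarrow>
    (\<exists>a :: (nat \<Rightarrow> nat) \<Rightarrow> int.
        (\<exists>e\<in>exps d C. a e \<noteq> 0) \<and>
        (\<forall>e\<in>exps d C. real_of_int \<bar>a e\<bar> \<le> real N powr C) \<and>
        real (card {x\<in>S. poly_eval d C a x = 0}) > (1 - \<eta>) * real (card S))"
proof -
  have d: "d > 0" using assms(1) by simp
  \<comment> \<open>Halving leaves room for the strict inequality in the conclusion.\<close>
  define \<eta>' where "\<eta>' = \<eta> / 2"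
  \<comment> \<open>Converts the lower bound for the weight from \<open>ln Q\<close> to
    \<open>ln N\<close>.\<close>
  define \<kappa>' where "\<kappa>' = \<kappa> * (\<epsilon> / (2 * real d))"
  have pos: "\<eta>' > 0" "\<kappa>' > 0" using assms by (auto simp: \<eta>'_def \<kappa>'_def)
  \<comment> \<open>The constant \<open>c0 * \<eta>'\<close> makes the result available for every
    remaining part of \<open>S\<close> that still has a proportion \<open>\<eta>'\<close> of the
    points.\<close>
  obtain \<delta>0 \<beta> c :: real and K :: nat where \<delta>0: "\<delta>0 > 0" and ev: "\<And>D. D > 0 \<Longrightarrow> \<forall>\<^sub>F N in sequentially. \<forall>P S.
    (\<forall>p\<in>P. prime p \<and> real p \<le> real N powr (\<epsilon> / (2 * real d))) \<longrightarrow> \<kappa>' * ln (real N) \<le> wP P \<longrightarrow>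
    S \<subseteq> grid N d \<longrightarrow> (c0 * \<eta>') * real N powr (real k - 1 + \<epsilon>) \<le> real (card S) \<longrightarrow>
    (\<forall>p\<in>P. real (card (res p ` S)) \<le> \<alpha> * real p ^ k) \<longrightarrow> capturable N d k D P \<delta>0 \<beta> c K S"
    using eventually_capturable[OF d assms(2,5) pos(2), of "c0 * \<eta>'" k] assms(6) pos by auto
  define \<delta> where "\<delta> = min \<delta>0 1"
  have \<delta>: "0 < \<delta>" "\<delta> \<le> 1" using \<delta>0 by (auto simp: \<delta>_def)
  obtain n where n: "(1 - \<delta>) ^ n \<le> \<eta>'"
    using real_arch_pow_inv[of \<eta>' "1 - \<delta>"] pos \<delta> by (auto intro: less_imp_le)
  define K' where "K' = n * K"
  \<comment> \<open>As \<open>D \<le> 4 * d * n1\<close>, the set to be annihilated has at most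
    \<open>K' * (4 * d * n1) ^ k\<close> points. Since k is less than d, the box of
    \<open>n1 ^ d\<close> exponents is at least twice as large once \<open>n1\<close> exceeds
    \<open>2 * K' * (4 * d) ^ k\<close>.\<close>
  define n1 where "n1 = 2 * K' * (4 * d) ^ k + 1"
  \<comment> \<open>For \<open>N \<ge> n1 ^ d\<close> Siegel's lemma gives
    \<open>H \<le> N ^ (d * n1 + 1)\<close> and values of size at most \<open>H^2\<close>, that is
    \<open>N ^ D\<close>.\<close>
  define D where "D = 2 * (d * n1 + 1)"
  have n1: "n1 > 0" and D: "D > 0" by (auto simp: n1_def D_def)
  have count: "2 * (K' * D ^ k) \<le> n1 ^ d"
  proof -
    have "1 \<le> d * n1" using d n1 by simp
    then have "D ^ k \<le> (4 * d * n1) ^ k" by (intro power_mono) (auto simp: D_def)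
    then have "2 * (K' * D ^ k) \<le> 2 * (K' * (4 * d * n1) ^ k)" by simp
    also have "\<dots> = (2 * K' * (4 * d) ^ k) * n1 ^ k" by (simp add: power_mult_distrib)
    also have "\<dots> \<le> n1 * n1 ^ k" by (intro mult_right_mono) (auto simp: n1_def)
    also have "\<dots> = n1 ^ Suc k" by simp
    also have "\<dots> \<le> n1 ^ d" using assms(1) n1 by (intro power_increasing) auto
    finally show ?thesis .
  qed
  obtain N0 where N0: "\<forall>N\<ge>N0. \<forall>P S.
    (\<forall>p\<in>P. prime p \<and> real p \<le> real N powr (\<epsilon> / (2 * real d))) \<longrightarrow> \<kappa>' * ln (real N) \<le> wP P \<longrightarrow>
    S \<subseteq> grid N d \<longrightarrow> (c0 * \<eta>') * real N powr (real k - 1 + \<epsilon>) \<le> real (card S) \<longrightarrow>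
    (\<forall>p\<in>P. real (card (res p ` S)) \<le> \<alpha> * real p ^ k) \<longrightarrow> capturable N d k D P \<delta>0 \<beta> c K S"
    using ev[OF D] unfolding eventually_sequentially ..
  note N0 = N0[THEN spec, THEN mp, THEN spec, THEN spec, THEN mp, THEN mp, THEN mp, THEN mp, THEN mp]
  define N1 where "N1 = max N0 (max 2 (n1 ^ d))"
  \<comment> \<open>Serves the bounded range \<open>N < N1\<close>: the exponent box of side
    \<open>n2\<close> is at least twice as large as the whole grid, so Siegel's lemma annihilates
    every grid point.\<close>
  define n2 where "n2 = 2 * (N1 + 1)"
  \<comment> \<open>One constant for all ranges of N: it dominates the degrees and the coefficient
    exponents of both applications of Siegel's lemma, and the degree 2 needed for
    \<open>N = 1\<close>.\<close>
  define C where "C = d * n1 + 1 + (n2 ^ d + d * n2) + 2"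
  have n2: "n2 > 0" by (simp add: n2_def)
  have C1: "real (d * n1) \<le> real C" and C2: "real (d * n2) \<le> real C"
    unfolding of_nat_le_iff by (simp_all add: C_def)
  show ?thesis
  proof (intro exI[of _ "real C"] allI impI)
    fix N :: nat and P :: "nat set" and S :: "(nat \<Rightarrow> int) set"
    assume N: "N > 0" and P: "P \<subseteq> {p. prime p \<and> real p \<le> real N powr (\<epsilon> / (2 * real d))}"
      and W: "wP P \<ge> \<kappa> * ln (real N powr (\<epsilon> / (2 * real d)))" and S: "S \<subseteq> grid N d"
      and size: "real (card S) \<ge> c0 * real N powr (real k - 1 + \<epsilon>)"
      and cl: "\<forall>p\<in>P. real (card (residue_classes p S)) \<le> \<alpha> * real p ^ k"
    have fin: "finite S" using S finite_grid finite_subset by blast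
    have "0 < c0 * real N powr (real k - 1 + \<epsilon>)" using assms N by simp
    then have cS: "real (card S) > 0" using size by linarith
    have coeff: "real_of_int \<bar>a e\<bar> \<le> real N powr real C"
      if "\<bar>a e\<bar> \<le> int H" "H \<le> N ^ m" "m \<le> C" for a :: "(nat \<Rightarrow> nat) \<Rightarrow> int" and e H m
    proof -
      have "\<bar>a e\<bar> \<le> int (N ^ m)" using that(1,2) by (meson of_nat_mono order.trans)
      also have "\<dots> \<le> int (N ^ C)" using that(3) N by (intro of_nat_mono power_increasing) auto
      finally have "real_of_int \<bar>a e\<bar> \<le> real_of_int (int (N ^ C))" by (rule of_int_le_iff[THEN iffD2])
      then show ?thesis using N by (simp add: powr_realpow)
    qed
    have all_zero: "real (card {x\<in>S. poly_eval d C a x = 0}) > (1 - \<eta>) * real (card S)"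
      if "\<And>x. x \<in> S \<Longrightarrow> poly_eval d C a x = 0" for a
    proof -
      have "{x\<in>S. poly_eval d C a x = 0} = S" using that by auto
      then show ?thesis using cS assms(3) by (simp add: algebra_simps)
    qed
    show "\<exists>a. (\<exists>e\<in>exps d C. a e \<noteq> 0) \<and> (\<forall>e\<in>exps d C. real_of_int \<bar>a e\<bar> \<le> real N powr C) \<and>
        real (card {x\<in>S. poly_eval d C a x = 0}) > (1 - \<eta>) * real (card S)"
    proof (cases "N = 1")
      case True
      define a :: "(nat \<Rightarrow> nat) \<Rightarrow> int" where
        "a = (\<lambda>e. if e = (\<lambda>_. 0)(0 := 2) then 1 else if e = (\<lambda>_. 0)(0 := 1) then -1 else 0)"
      have "2 \<le> real C" by (simp add: C_def)
      note pb = poly_eval_boolean[OF d this, folded a_def]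
      have "poly_eval d C a x = 0" if "x \<in> S" for x
      proof -
        have "0 \<le> x 0" "x 0 \<le> 1" using that S d True by (auto simp: grid_def)
        then have "x 0 = 0 \<or> x 0 = 1" by linarith
        then show ?thesis by (auto simp: pb)
      qed
      then show ?thesis using pb(2) True by (intro exI[of _ a] conjI all_zero) (auto simp: a_def)
    next
      case False
      then have N2: "N \<ge> 2" using N by simp
      show ?thesis
      proof (cases "N < N1")
        case True
        have "card (grid N d) = (N + 1) ^ d"
        proof -
          have "grid N d = {e. (\<forall>i<d. e i \<in> {0..int N}) \<and> (\<forall>i\<ge>d. e i = 0)}"
            by (auto simp: grid_def)
          then show ?thesis using finite_card_box(2)[of d "\<lambda>_. {0..int N}" 0] by (simp add: nat_add_distrib)
        qed
        then have "2 * card (grid N d) \<le> 2 ^ d * (N + 1) ^ d" using d self_le_power[of "2::nat" d] by simp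
        also have "\<dots> \<le> n2 ^ d" using True by (simp only: power_mult_distrib[symmetric]) (auto intro!: power_mono simp: n2_def)
        finally have "2 * card (grid N d) \<le> n2 ^ d" .
        then obtain a where a: "\<exists>e\<in>exps d C. a e \<noteq> 0" "\<And>e. \<bar>a e\<bar> \<le> int (n2 ^ d * N ^ (d * n2))"
          "\<And>x. x \<in> grid N d \<Longrightarrow> poly_eval d C a x = 0"
          by (rule siegel[OF subset_refl n2 N _ C2]) blast
        \<comment> \<open>Here \<open>N \<ge> 2\<close> turns the constant factor
          \<open>n2 ^ d\<close> into a bounded power of N.\<close>
        have "n2 ^ d \<le> 2 ^ (n2 ^ d)" using less_exp[of "n2 ^ d"] by simp
        also have "\<dots> \<le> N ^ (n2 ^ d)" using N2 by (intro power_mono) auto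
        finally have "n2 ^ d * N ^ (d * n2) \<le> N ^ (n2 ^ d + d * n2)" by (simp add: power_add)
        moreover have "n2 ^ d + d * n2 \<le> C" by (simp add: C_def)
        ultimately show ?thesis
          by (intro exI[of _ a] conjI ballI a(1) coeff[OF a(2)] all_zero a(3) subsetD[OF S])
      next
        case False
        then have NN: "N \<ge> N0" "N \<ge> n1 ^ d" by (auto simp: N1_def)
        have P': "\<forall>p\<in>P. prime p \<and> real p \<le> real N powr (\<epsilon> / (2 * real d))" using P by auto
        have W': "\<kappa>' * ln (real N) \<le> wP P" using W N by (simp add: \<kappa>'_def ln_powr mult_ac)
        have cap: "capturable N d k D P \<delta>0 \<beta> c K S0"
          if S0: "S0 \<subseteq> S" "\<eta>' * real (card S) \<le> real (card S0)" for S0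
        proof -
          have "\<eta>' * (c0 * real N powr (real k - 1 + \<epsilon>)) \<le> \<eta>' * real (card S)"
            using size pos by (intro mult_left_mono) auto
          then have size0: "(c0 * \<eta>') * real N powr (real k - 1 + \<epsilon>) \<le> real (card S0)"
            using S0(2) by (simp add: mult_ac)
          have cl0: "\<forall>p\<in>P. real (card (res p ` S0)) \<le> \<alpha> * real p ^ k"
          proof
            fix p assume p: "p \<in> P"
            have "card (res p ` S0) \<le> card (res p ` S)" using fin S0(1) by (intro card_mono image_mono) auto
            then show "real (card (res p ` S0)) \<le> \<alpha> * real p ^ k"
              using cl p unfolding residue_classes_eq by fastforce
          qed
          show ?thesis using S0(1) S by (intro N0[OF NN(1) P' W' _ size0 cl0]) auto
        qed
        have ex: "\<exists>U\<subseteq>S. \<exists>A\<subseteq>S. card A \<le> n * (K * D ^ k) \<and>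
          real (card (S - U)) \<le> max \<eta>' ((1 - \<delta>) ^ n) * real (card S) \<and>
          (\<forall>f. cong_preserving f \<longrightarrow> (\<forall>x\<in>grid N d. \<bar>f x\<bar> \<le> int N ^ D) \<longrightarrow> (\<forall>x\<in>A. f x = 0)
            \<longrightarrow> (\<forall>x\<in>U. f x = 0))"
          unfolding \<delta>_def by (rule iterate_capturable[OF fin \<delta>0 cap])
        obtain U A where U: "U \<subseteq> S" "real (card (S - U)) \<le> max \<eta>' ((1 - \<delta>) ^ n) * real (card S)"
          and A: "A \<subseteq> S" "card A \<le> n * (K * D ^ k)"
          and v: "\<forall>f. cong_preserving f \<longrightarrow> (\<forall>x\<in>grid N d. \<bar>f x\<bar> \<le> int N ^ D) \<longrightarrow> (\<forall>x\<in>A. f x = 0)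
            \<longrightarrow> (\<forall>x\<in>U. f x = 0)"
          using ex by (elim exE conjE) (rule that; assumption)
        have "2 * card A \<le> n1 ^ d" using A(2) count by (simp add: K'_def mult_ac)
        then obtain a where a: "\<exists>e\<in>exps d C. a e \<noteq> 0" "\<And>e. \<bar>a e\<bar> \<le> int (n1 ^ d * N ^ (d * n1))"
          "\<And>x. x \<in> A \<Longrightarrow> poly_eval d C a x = 0"
          "\<And>x. x \<in> grid N d \<Longrightarrow> \<bar>poly_eval d C a x\<bar> \<le> int ((n1 ^ d * N ^ (d * n1))\<^sup>2)"
          by (rule siegel[OF subset_trans[OF A(1) S] n1 N _ C1]) blast
        \<comment> \<open>In this range \<open>n1 ^ d \<le> N\<close> costs just one further power
          of N.\<close>
        have H: "n1 ^ d * N ^ (d * n1) \<le> N ^ (d * n1 + 1)" using NN(2) by simp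
        have "(n1 ^ d * N ^ (d * n1))\<^sup>2 \<le> (N ^ (d * n1 + 1))\<^sup>2" by (rule power_mono[OF H]) simp
        also have "\<dots> = N ^ D" by (simp only: D_def power_mult[symmetric] mult.commute)
        finally have "int ((n1 ^ d * N ^ (d * n1))\<^sup>2) \<le> int (N ^ D)" by (rule of_nat_mono)
        then have "int ((n1 ^ d * N ^ (d * n1))\<^sup>2) \<le> int N ^ D" by (simp only: of_nat_power[of N D])
        then have bnd: "\<forall>x\<in>grid N d. \<bar>poly_eval d C a x\<bar> \<le> int N ^ D"
          by (intro ballI order.trans[OF a(4)])
        \<comment> \<open>The polynomial was made to vanish only on the small set \<open>A\<close>;
          preserving congruences and staying below \<open>N ^ D\<close>, it is forced to vanish on
          all of \<open>U\<close>.\<close>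
        have "\<forall>x\<in>A. poly_eval d C a x = 0" using a(3) by (rule ballI)
        then have U0: "\<forall>x\<in>U. poly_eval d C a x = 0"
          by (rule v[THEN spec, THEN mp, OF cong_preserving_poly_eval, THEN mp, OF bnd, THEN mp])
        have "(1 - \<eta>) * real (card S) < real (card {x\<in>S. poly_eval d C a x = 0})"
        proof -
          have "real (card (S - U)) \<le> \<eta>' * real (card S)" using U(2) n by (simp add: max_def)
          moreover have "real (card (S - U)) = real (card S) - real (card U)"
            using fin U(1) finite_subset[OF U(1)] by (simp add: card_Diff_subset card_mono of_nat_diff)
          moreover have "\<eta>' * real (card S) < \<eta> * real (card S)" using cS assms(3) by (simp add: \<eta>'_def)
          moreover have "card U \<le> card {x\<in>S. poly_eval d C a x = 0}"
            using fin U(1) U0 by (intro card_mono) auto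
          ultimately show ?thesis by (simp add: algebra_simps)
        qed
        moreover have "d * n1 + 1 \<le> C" by (simp add: C_def)
        ultimately show ?thesis
          by (intro exI[of _ a] conjI ballI a(1) coeff[OF a(2) H])
      qed
    qed
  qed
qed

end
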